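(* Let $n\ge 1$ and let $\Sigma_0=\mathbb{S}^n(1/\sqrt{2})\times\mathbb{S}^n(1/\sqrt{2})\subset\mathbb{R}^{n+1}\times\mathbb{R}^{n+1}$ be the minimal Clifford torus of the unit sphere $\mathbb{S}^{2n+1}\subset\mathbb{R}^{2n+2}$. Let $\boldsymbol{J}=\begin{pmatrix}0&-\mathrm{Id}\\ \mathrm{Id}&0\end{pmatrix}$ be the $(2n+2)\times(2n+2)$ block matrix, where $\mathrm{Id}$ is the identity matrix of order $n+1$. Then, for any $a,k>0$, the $a$-pitched twisting $$\Sigma=\Sigma(a,k):=\{(e^{(ks)\boldsymbol{J}}p,as)\,;\,p\in\Sigma_0,\ s\in\mathbb{R}\}\subset\mathbb{S}^{2n+1}\times\mathbb{R}$$ is a properly embedded vertical helicoid in $\mathbb{S}^{2n+1}\times\mathbb{R}$. Furthermore, for any fixed $a>0$, the parameter $k$ can be chosen in such a way that $\Sigma(a,k)$ contains open spacelike zero mean isocurved subsets.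
   Context: For a Riemannian manifold $M$, $M\times\mathbb{R}$ carries the product metric $\langle\,,\rangle=\langle\,,\rangle_M+dt^2$ with Levi-Civita connection $\overline\nabla$; $\partial_t$ is the unit vertical field. For an orientable hypersurface $\Sigma\subset M\times\mathbb{R}$ with unit normal $N$: the shape operator is $AX=-\overline\nabla_XN$; the mean curvature is $H=\mathrm{trace}\,A$ (not normalized); $\xi$ is the restriction to $\Sigma$ of the projection onto $\mathbb{R}$, with gradient $\nabla\xi$ on $\Sigma$; $\Theta=\langle N,\partial_t\rangle$ is the angle function. A horizontal point is a point where $\Theta^2=1$ (a critical point of $\xi$). A horizontal section of $\Sigma$ is $\Sigma_t=\Sigma\cap(M\times\{t\})$ when the intersection is transversal. Vertical helicoid: a hypersurface with no horizontal points and nonconstant angle function whose horizontal sections $\Sigma_t$ are minimal hypersurfaces of $M\times\{t\}$ and such that $\langle A\nabla\xi,\nabla\xi\rangle=0$ on $\Sigma$. Lorentzian notions: $\langle\,,\rangle_L=\langle\,,\rangle_M-dt^2$. $\Sigma$ is spacelike if $\langle\,,\rangle_L$ is positive definite on $\Sigma$ (equivalently $2\Theta^2>1$). For spacelike $\Sigma$, put $N_L=\mu\,(N-2\Theta\partial_t)$ with $\mu=-1/\sqrt{2\Theta^2-1}$ (so $\langle N_L,N_L\rangle_L=-1$), $A_LX=-\overline\nabla_XN_L$, $H_L=-\mathrm{trace}\,A_L$. A spacelike $\Sigma$ is zero mean isocurved if $H=H_L=0$. *)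

theory Defs
  imports "HOL-Analysis.Analysis"
begin

text \<open>\<open>Ck_on\<close> and \<open>smooth_on\<close> are meant for open sets only.\<close>

primrec Ck_on :: "nat \<Rightarrow> 'a::euclidean_space set \<Rightarrow> ('a \<Rightarrow> 'b::euclidean_space) \<Rightarrow> bool" where
  "Ck_on 0 U f \<longleftrightarrow> continuous_on U f"
| "Ck_on (Suc k) U f \<longleftrightarrow>
     f differentiable_on U \<and> (\<forall>v. Ck_on k U (\<lambda>x. frechet_derivative f (at x) v))"

definition smooth_on :: "'a::euclidean_space set \<Rightarrow> ('a \<Rightarrow> 'b::euclidean_space) \<Rightarrow> bool" where
  "smooth_on U f \<longleftrightarrow> (\<forall>k. Ck_on k U f)"

definition smooth_along :: "'a::euclidean_space set \<Rightarrow> ('a \<Rightarrow> 'b::euclidean_space) \<Rightarrow> bool" where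
  "smooth_along S f \<longleftrightarrow>
     (\<forall>p\<in>S. \<exists>U g. open U \<and> p \<in> U \<and> smooth_on U g \<and> (\<forall>x\<in>U \<inter> S. g x = f x))"

text \<open>Embedded submanifolds (without boundary) of dimension \<open>d\<close>, by slice charts.\<close>

definition smooth_submanifold :: "nat \<Rightarrow> 'a::euclidean_space set \<Rightarrow> bool" where
  "smooth_submanifold d S \<longleftrightarrow>
     (\<forall>p\<in>S. \<exists>(U::'a set) (V::'a set) \<phi> \<psi> L.
        open U \<and> p \<in> U \<and> open V \<and> homeomorphism U V \<phi> \<psi> \<and> smooth_on U \<phi> \<and> smooth_on V \<psi> \<and>
        subspace L \<and> dim L = d \<and> \<phi> ` (U \<inter> S) = V \<inter> L)"

definition hypersurface :: "'a::euclidean_space set \<Rightarrow> 'a set \<Rightarrow> bool" where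
  "hypersurface P S \<longleftrightarrow>
     S \<subseteq> P \<and> (\<exists>d. smooth_submanifold (Suc d) P \<and> smooth_submanifold d S)"

text \<open>\<open>K \<inter> S\<close> is the preimage of \<open>K\<close> under the inclusion of \<open>S\<close> into \<open>P\<close>.\<close>

definition properly_embedded_hypersurface :: "'a::euclidean_space set \<Rightarrow> 'a set \<Rightarrow> bool" where
  "properly_embedded_hypersurface P S \<longleftrightarrow>
     hypersurface P S \<and> (\<forall>K. K \<subseteq> P \<longrightarrow> compact K \<longrightarrow> compact (K \<inter> S))"

definition curve_through ::
    "'a::euclidean_space set \<Rightarrow> 'a \<Rightarrow> 'a \<Rightarrow> (real \<Rightarrow> 'a) \<Rightarrow> bool" where
  "curve_through S p v \<gamma> \<longleftrightarrow>
     (\<exists>\<epsilon>>0. smooth_on {-\<epsilon><..<\<epsilon>} \<gamma> \<and> \<gamma> ` {-\<epsilon><..<\<epsilon>} \<subseteq> S) \<and>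
     \<gamma> 0 = p \<and> (\<gamma> has_vector_derivative v) (at 0)"

definition tangent_space :: "'a::euclidean_space set \<Rightarrow> 'a \<Rightarrow> 'a set" where
  "tangent_space S p = {v. \<exists>\<gamma>. curve_through S p v \<gamma>}"

text \<open>
  The derivative at \<open>p\<close> in the tangent direction \<open>v\<close> of a map defined along \<open>S\<close>; for smooth maps
  it does not depend on the curve.
\<close>

definition deriv_along ::
    "'a::euclidean_space set \<Rightarrow> ('a \<Rightarrow> 'b::euclidean_space) \<Rightarrow> 'a \<Rightarrow> 'a \<Rightarrow> 'b" where
  "deriv_along S f p v =
     (THE w. \<exists>\<gamma>. curve_through S p v \<gamma> \<and> ((f \<circ> \<gamma>) has_vector_derivative w) (at 0))"

definition orth_proj :: "'a::euclidean_space set \<Rightarrow> 'a \<Rightarrow> 'a" where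
  "orth_proj V w = (THE u. u \<in> V \<and> (\<forall>v\<in>V. (w - u) \<bullet> v = 0))"

text \<open>The trace of an endomorphism of the subspace \<open>V\<close>; any basis gives the same value.\<close>

definition trace_on :: "'a::euclidean_space set \<Rightarrow> ('a \<Rightarrow> 'a) \<Rightarrow> real" where
  "trace_on V T =
     (let B = (SOME B. independent B \<and> span B = V) in \<Sum>b\<in>B. representation B (T b) b)"

text \<open>
  Riemannian manifolds are submanifolds \<open>P\<close> of a Euclidean space with the induced metric. Their
  Levi-Civita connection is the tangential part of the derivative in the Euclidean space; here it
  is applied to fields \<open>Y\<close> that are tangent to \<open>P\<close> and defined along a submanifold \<open>S\<close> of \<open>P\<close>.
\<close>

definition cov_deriv ::
    "'a::euclidean_space set \<Rightarrow> 'a set \<Rightarrow> ('a \<Rightarrow> 'a) \<Rightarrow> 'a \<Rightarrow> 'a \<Rightarrow> 'a" where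
  "cov_deriv P S Y p X = orth_proj (tangent_space P p) (deriv_along S Y p X)"

definition unit_normal_field ::
    "'a::euclidean_space set \<Rightarrow> 'a set \<Rightarrow> ('a \<Rightarrow> 'a) \<Rightarrow> bool" where
  "unit_normal_field P S N \<longleftrightarrow> smooth_along S N \<and>
     (\<forall>p\<in>S. N p \<in> tangent_space P p \<and> norm (N p) = 1 \<and> (\<forall>v\<in>tangent_space S p. N p \<bullet> v = 0))"

definition shape_operator ::
    "'a::euclidean_space set \<Rightarrow> 'a set \<Rightarrow> ('a \<Rightarrow> 'a) \<Rightarrow> 'a \<Rightarrow> 'a \<Rightarrow> 'a" where
  "shape_operator P S N p X = - cov_deriv P S N p X"

definition mean_curvature ::
    "'a::euclidean_space set \<Rightarrow> 'a set \<Rightarrow> ('a \<Rightarrow> 'a) \<Rightarrow> 'a \<Rightarrow> real" where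
  "mean_curvature P S N p = trace_on (tangent_space S p) (shape_operator P S N p)"

definition minimal_hypersurface :: "'a::euclidean_space set \<Rightarrow> 'a set \<Rightarrow> bool" where
  "minimal_hypersurface P S \<longleftrightarrow>
     hypersurface P S \<and> (\<exists>N. unit_normal_field P S N \<and> (\<forall>p\<in>S. mean_curvature P S N p = 0))"

definition gradient :: "'a::euclidean_space set \<Rightarrow> ('a \<Rightarrow> real) \<Rightarrow> 'a \<Rightarrow> 'a" where
  "gradient S f p =
     (THE g. g \<in> tangent_space S p \<and> (\<forall>X\<in>tangent_space S p. g \<bullet> X = deriv_along S f p X))"

definition vertical_field :: "'a::euclidean_space \<times> real" ("\<partial>t") where
  "\<partial>t = (0, 1)"

definition angle_function ::
    "('a::euclidean_space \<times> real \<Rightarrow> 'a \<times> real) \<Rightarrow> 'a \<times> real \<Rightarrow> real" where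
  "angle_function N p = N p \<bullet> \<partial>t"

definition horizontal_point ::
    "('a::euclidean_space \<times> real \<Rightarrow> 'a \<times> real) \<Rightarrow> 'a \<times> real \<Rightarrow> bool" where
  "horizontal_point N p \<longleftrightarrow> (angle_function N p)\<^sup>2 = 1"

definition transversal_slice ::
    "'a::euclidean_space set \<Rightarrow> ('a \<times> real) set \<Rightarrow> real \<Rightarrow> bool" where
  "transversal_slice M S t \<longleftrightarrow>
     (\<forall>p\<in>S \<inter> (M \<times> {t}).
        {u + v |u v. u \<in> tangent_space S p \<and> v \<in> tangent_space (M \<times> {t}) p}
          = tangent_space (M \<times> UNIV) p)"

definition vertical_helicoid ::
    "'a::euclidean_space set \<Rightarrow> ('a \<times> real) set \<Rightarrow> ('a \<times> real \<Rightarrow> 'a \<times> real) \<Rightarrow> bool" where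
  "vertical_helicoid M S N \<longleftrightarrow>
     hypersurface (M \<times> UNIV) S \<and> unit_normal_field (M \<times> UNIV) S N \<and>
     (\<forall>p\<in>S. \<not> horizontal_point N p) \<and>
     \<not> angle_function N constant_on S \<and>
     (\<forall>t. transversal_slice M S t \<longrightarrow> minimal_hypersurface (M \<times> {t}) (S \<inter> (M \<times> {t}))) \<and>
     (\<forall>p\<in>S. shape_operator (M \<times> UNIV) S N p (gradient S snd p) \<bullet> gradient S snd p = 0)"

definition lorentz_product :: "'a::euclidean_space \<times> real \<Rightarrow> 'a \<times> real \<Rightarrow> real" where
  "lorentz_product v w = fst v \<bullet> fst w - snd v * snd w"

definition spacelike :: "('a::euclidean_space \<times> real) set \<Rightarrow> bool" where
  "spacelike S \<longleftrightarrow> (\<forall>p\<in>S. \<forall>X\<in>tangent_space S p. X \<noteq> 0 \<longrightarrow> lorentz_product X X > 0)"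

text \<open>On spacelike hypersurfaces the radicand is positive, and the vector below is a unit timelike
  normal for the Lorentzian product.\<close>

definition lorentz_normal ::
    "('a::euclidean_space \<times> real \<Rightarrow> 'a \<times> real) \<Rightarrow> 'a \<times> real \<Rightarrow> 'a \<times> real" where
  "lorentz_normal N p =
     (- 1 / sqrt (2 * (angle_function N p)\<^sup>2 - 1)) *\<^sub>R (N p - (2 * angle_function N p) *\<^sub>R \<partial>t)"

text \<open>
  The Riemannian and the Lorentzian product metrics have the same Levi-Civita connection, so
  \<^term>\<open>cov_deriv\<close> serves for both.
\<close>

definition lorentz_shape_operator ::
    "'a::euclidean_space set \<Rightarrow> ('a \<times> real) set \<Rightarrow> ('a \<times> real \<Rightarrow> 'a \<times> real) \<Rightarrow>
       'a \<times> real \<Rightarrow> 'a \<times> real \<Rightarrow> 'a \<times> real" where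
  "lorentz_shape_operator M S N p X = - cov_deriv (M \<times> UNIV) S (lorentz_normal N) p X"

definition lorentz_mean_curvature ::
    "'a::euclidean_space set \<Rightarrow> ('a \<times> real) set \<Rightarrow> ('a \<times> real \<Rightarrow> 'a \<times> real) \<Rightarrow>
       'a \<times> real \<Rightarrow> real" where
  "lorentz_mean_curvature M S N p =
     - trace_on (tangent_space S p) (lorentz_shape_operator M S N p)"

definition zero_mean_isocurved ::
    "'a::euclidean_space set \<Rightarrow> ('a \<times> real) set \<Rightarrow> ('a \<times> real \<Rightarrow> 'a \<times> real) \<Rightarrow> bool" where
  "zero_mean_isocurved M S N \<longleftrightarrow>
     hypersurface (M \<times> UNIV) S \<and> unit_normal_field (M \<times> UNIV) S N \<and> spacelike S \<and>
     (\<forall>p\<in>S. mean_curvature (M \<times> UNIV) S N p = 0 \<and> lorentz_mean_curvature M S N p = 0)"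

definition block_op ::
    "real^'n^'n \<Rightarrow> real^'n^'n \<Rightarrow> real^'n^'n \<Rightarrow> real^'n^'n \<Rightarrow>
       (real^'n) \<times> (real^'n) \<Rightarrow> (real^'n) \<times> (real^'n)" where
  "block_op A B C D z = (A *v fst z + B *v snd z, C *v fst z + D *v snd z)"

definition J_op :: "(real^'n) \<times> (real^'n) \<Rightarrow> (real^'n) \<times> (real^'n)" where
  "J_op = block_op 0 (- mat 1) (mat 1) 0"

text \<open>The vector \<open>e\<^sup>T p\<close> for a linear \<open>T\<close>.\<close>

definition exp_op :: "('a::euclidean_space \<Rightarrow> 'a) \<Rightarrow> 'a \<Rightarrow> 'a" where
  "exp_op T p = (\<Sum>m. (T ^^ m) p /\<^sub>R fact m)"

definition clifford_torus :: "((real^'n) \<times> (real^'n)) set" where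
  "clifford_torus = sphere 0 (1 / sqrt 2) \<times> sphere 0 (1 / sqrt 2)"

definition twisted_clifford :: "real \<Rightarrow> real \<Rightarrow> (((real^'n) \<times> (real^'n)) \<times> real) set" where
  "twisted_clifford a k =
     {(exp_op (\<lambda>z. (k * s) *\<^sub>R J_op z) p, a * s) |p s. p \<in> clifford_torus}"

end

theory Submission
  imports Defs
begin

text \<open>
  Identify \<open>(x, y)\<close> with \<open>z = x + \<i>y\<close> and put \<open>c = k / a\<close>. Then \<open>\<Sigma>(a, k)\<close> is the set of all
  \<open>(z, t)\<close> with \<open>norm z = 1\<close> and \<open>F = R z \<bullet> z = 0\<close>, where \<open>R z = e\<^sup>2\<^sup>\<i>\<^sup>c\<^sup>t cnj z\<close> is
  a symmetric traceless involution, and \<open>dR/dt = 2c C\<close> with \<open>C = \<i>R\<close>, so that \<open>C z \<bullet> R z = 0\<close>.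
  With \<open>G = C z \<bullet> z\<close> the vector \<open>W = (R z, cG)\<close> is normal, and \<open>|G| \<le> 1\<close> is not constant on \<open>\<Sigma>\<close>.
  The derivative of \<open>W\<close> is \<open>(v, \<tau>) \<mapsto> (R v + 2c\<tau> C z, 2c C z \<bullet> v)\<close>; its trace and its values on
  \<open>(z, 0)\<close>, \<open>W\<close> and the gradient of the height all vanish because of \<open>R\<^sup>2 = 1\<close>, \<open>C z \<bullet> R z = 0\<close> and
  \<open>F = 0\<close>. The same computation applies to \<open>(R z, -cG)\<close>, which is proportional to the Lorentzian normal,
  and to \<open>R\<close> alone for the horizontal sections. The spacelike part is \<open>c\<^sup>2 G\<^sup>2 > 1\<close>, which is nonempty
  as soon as \<open>c > 1\<close>.
\<close>

section \<open>Smooth maps\<close>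

text \<open>A Frechet derivative at an interior point depends only on the germ of the map, so
  agreement on an open set passes to all iterated derivatives.\<close>

lemma Ck_on_cong:
  assumes "open U" and "\<And>x. x \<in> U \<Longrightarrow> f x = g x" and "Ck_on k U f"
  shows "Ck_on k U g"
  using assms
proof (induction k arbitrary: f g)
  case 0
  then show ?case using continuous_on_cong[of U U f g] by simp
next
  case (Suc k)
  have d: "(g has_derivative frechet_derivative f (at x)) (at x)" if "x \<in> U" for x
  proof -
    have "f differentiable (at x)"
      using Suc.prems(1,3) that by (simp add: differentiable_on_eq_differentiable_at)
    then have "(f has_derivative frechet_derivative f (at x)) (at x)"
      by (simp add: frechet_derivative_works)
    then show ?thesis
      by (rule has_derivative_transform_within_open[OF _ Suc.prems(1) that Suc.prems(2)])
  qed
  then have "g differentiable_on U"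
    unfolding differentiable_on_def differentiable_def by (metis has_derivative_at_withinI)
  moreover have "Ck_on k U (\<lambda>x. frechet_derivative g (at x) v)" for v
  proof (rule Suc.IH[OF Suc.prems(1)])
    show "Ck_on k U (\<lambda>x. frechet_derivative f (at x) v)" using Suc.prems by auto
    show "frechet_derivative f (at x) v = frechet_derivative g (at x) v" if "x \<in> U" for x
      using frechet_derivative_at[OF d[OF that]] by simp
  qed
  ultimately show ?case by simp
qed

text \<open>Uniqueness of derivatives lets an explicit formula replace the chosen
  \<open>frechet_derivative\<close>. The closure properties below are inductions that use this rule
  at each order.\<close>

lemma Ck_on_SucI:
  assumes "open U" and "\<And>x. x \<in> U \<Longrightarrow> (f has_derivative f' x) (at x)"
    and "\<And>v. Ck_on k U (\<lambda>x. f' x v)"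
  shows "Ck_on (Suc k) U f"
proof -
  have "f differentiable_on U"
    unfolding differentiable_on_def differentiable_def
    using assms(2) has_derivative_at_withinI by blast
  moreover have "Ck_on k U (\<lambda>x. frechet_derivative f (at x) v)" for v
    by (rule Ck_on_cong[OF assms(1) _ assms(3)[of v]]) (simp add: frechet_derivative_at[OF assms(2)])
  ultimately show ?thesis by simp
qed

lemma Ck_on_SucD:
  assumes "open U" and "Ck_on (Suc k) U f" and "x \<in> U"
  shows "(f has_derivative frechet_derivative f (at x)) (at x)"
  using assms by (simp add: differentiable_on_eq_differentiable_at frechet_derivative_works)

lemma Ck_on_le: "Ck_on (Suc k) U f \<Longrightarrow> Ck_on k U f"
  by (induction k arbitrary: f) (auto intro: differentiable_imp_continuous_on)

lemma Ck_on_subset: "Ck_on k U f \<Longrightarrow> V \<subseteq> U \<Longrightarrow> Ck_on k V f"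
  by (induction k arbitrary: f) (auto intro: continuous_on_subset differentiable_on_subset)

lemma Ck_on_const: "Ck_on k U (\<lambda>x. c)"
  by (induction k arbitrary: c) (auto simp: frechet_derivative_const)

lemma Ck_on_linear:
  assumes "open U" "bounded_linear h" "Ck_on k U f"
  shows "Ck_on k U (\<lambda>x. h (f x))"
  using assms(3)
proof (induction k arbitrary: f)
  case 0
  then show ?case using assms(2) by (simp add: bounded_linear.continuous_on)
next
  case (Suc k)
  show ?case
  proof (rule Ck_on_SucI[OF assms(1)])
    show "((\<lambda>x. h (f x)) has_derivative (\<lambda>v. h (frechet_derivative f (at x) v))) (at x)" if "x \<in> U" for x
      by (rule bounded_linear.has_derivative[OF assms(2) Ck_on_SucD[OF assms(1) Suc.prems that]])
    show "Ck_on k U (\<lambda>x. h (frechet_derivative f (at x) v))" for v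
      using Suc by auto
  qed
qed

lemma Ck_on_add:
  assumes "open U" "Ck_on k U f" "Ck_on k U g"
  shows "Ck_on k U (\<lambda>x. f x + g x)"
  using assms(2,3)
proof (induction k arbitrary: f g)
  case 0
  then show ?case by (simp add: continuous_on_add)
next
  case (Suc k)
  show ?case
  proof (rule Ck_on_SucI[OF assms(1)])
    show "((\<lambda>x. f x + g x) has_derivative
        (\<lambda>v. frechet_derivative f (at x) v + frechet_derivative g (at x) v)) (at x)" if "x \<in> U" for x
      using Suc.prems that by (intro has_derivative_add Ck_on_SucD[OF assms(1)])
    show "Ck_on k U (\<lambda>x. frechet_derivative f (at x) v + frechet_derivative g (at x) v)" for v
      using Suc by auto
  qed
qed

lemma Ck_on_sum:
  assumes "open U" "\<And>i. i \<in> I \<Longrightarrow> Ck_on k U (f i)"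
  shows "Ck_on k U (\<lambda>x. \<Sum>i\<in>I. f i x)"
  using assms(2)
  by (induction I rule: infinite_finite_induct) (auto intro: Ck_on_const Ck_on_add[OF assms(1)])

lemma Ck_on_bilinear:
  assumes "open U" "bounded_bilinear h" "Ck_on k U f" "Ck_on k U g"
  shows "Ck_on k U (\<lambda>x. h (f x) (g x))"
  using assms(3,4)
proof (induction k arbitrary: f g)
  case 0
  then show ?case using assms(2) by (simp add: bounded_bilinear.continuous_on)
next
  case (Suc k)
  show ?case
  proof (rule Ck_on_SucI[OF assms(1)])
    show "((\<lambda>x. h (f x) (g x)) has_derivative
        (\<lambda>v. h (f x) (frechet_derivative g (at x) v) + h (frechet_derivative f (at x) v) (g x))) (at x)"
      if "x \<in> U" for x
      using Suc.prems that by (intro bounded_bilinear.FDERIV[OF assms(2)] Ck_on_SucD[OF assms(1)])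
    \<comment> \<open>The derivatives have order \<open>k\<close>, the undifferentiated factors
      order \<open>Suc k\<close>; \<open>Ck_on_le\<close> lowers the latter so that the induction
      hypothesis fits both products.\<close>
    show "Ck_on k U (\<lambda>x. h (f x) (frechet_derivative g (at x) v) + h (frechet_derivative f (at x) v) (g x))" for v
      using Suc.prems by (intro Ck_on_add[OF assms(1)] Suc.IH) (auto simp del: Ck_on.simps(2) dest: Ck_on_le, auto)
  qed
qed

lemma Ck_on_compose:
  fixes f :: "'b::euclidean_space \<Rightarrow> 'c::euclidean_space" and g :: "'a::euclidean_space \<Rightarrow> 'b"
  assumes "open U" "open V" "g ` U \<subseteq> V" "Ck_on k U g" "Ck_on k V f"
  shows "Ck_on k U (\<lambda>x. f (g x))"
  using assms(4,5)
proof (induction k arbitrary: f)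
  case 0
  then show ?case using assms(3) by (auto intro: continuous_on_compose2)
next
  case (Suc k)
  let ?f' = "\<lambda>x. frechet_derivative f (at x)" and ?g' = "\<lambda>x. frechet_derivative g (at x)"
  show ?case
  proof (rule Ck_on_SucI[OF assms(1)])
    fix x assume x: "x \<in> U"
    have f: "(f has_derivative ?f' (g x)) (at (g x))"
      using Ck_on_SucD[OF assms(2) Suc.prems(2)] x assms(3) by blast
    have fg: "((\<lambda>x. f (g x)) has_derivative (\<lambda>v. ?f' (g x) (?g' x v))) (at x)"
      using has_derivative_compose[OF Ck_on_SucD[OF assms(1) Suc.prems(1) x] f] .
    \<comment> \<open>In the chain rule the direction fed to the derivative of \<open>f\<close>
      varies with \<open>x\<close>, while \<open>Ck_on\<close> only controls fixed directions.
      Expanding in \<open>Basis\<close> leaves fixed directions with scalar coefficients.\<close>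
    have repr: "?f' (g x) w = (\<Sum>i\<in>Basis. (w \<bullet> i) *\<^sub>R ?f' (g x) i)" for w
      using linear_sum[OF has_derivative_linear[OF f], of "\<lambda>i. (w \<bullet> i) *\<^sub>R i" Basis]
      by (simp add: euclidean_representation linear_cmul[OF has_derivative_linear[OF f]])
    show "((\<lambda>x. f (g x)) has_derivative
        (\<lambda>v. \<Sum>i\<in>Basis. (?g' x v \<bullet> i) *\<^sub>R ?f' (g x) i)) (at x)"
      by (rule has_derivative_eq_rhs[OF fg], rule ext, rule repr)
  next
    fix v
    have "Ck_on k U (\<lambda>x. ?g' x v)" and f': "\<And>i. Ck_on k V (\<lambda>y. ?f' y i)"
      using Suc.prems by auto
    moreover have "Ck_on k U (\<lambda>x. ?f' (g x) i)" for i
      using Suc.IH[OF Ck_on_le[OF Suc.prems(1)] f'] .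
    ultimately show "Ck_on k U (\<lambda>x. \<Sum>i\<in>Basis. (?g' x v \<bullet> i) *\<^sub>R ?f' (g x) i)"
      by (intro Ck_on_sum Ck_on_bilinear[OF _ bounded_bilinear_scaleR]
          Ck_on_linear[OF _ bounded_linear_inner_left] assms(1))
  qed
qed

lemma Ck_on_real:
  assumes "open U" "\<And>x::real. x \<in> U \<Longrightarrow> (f has_field_derivative f' x) (at x)" "Ck_on k U f'"
  shows "Ck_on (Suc k) U (f::real \<Rightarrow> real)"
proof (rule Ck_on_SucI[OF assms(1)])
  show "(f has_derivative (\<lambda>v. f' x * v)) (at x)" if "x \<in> U" for x
    using assms(2)[OF that] by (simp add: has_field_derivative_def)
  show "Ck_on k U (\<lambda>x. f' x * v)" for v
    by (rule Ck_on_linear[OF assms(1) bounded_linear_mult_left assms(3)])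
qed

section \<open>Closure properties of smoothness and elementary functions\<close>

lemma smooth_on_const: "smooth_on U (\<lambda>x. c)"
  by (simp add: smooth_on_def Ck_on_const)

lemma smooth_on_id: "open U \<Longrightarrow> smooth_on U (\<lambda>x. x)"
  unfolding smooth_on_def
proof
  fix k assume "open U"
  show "Ck_on k U (\<lambda>x. x)"
  proof (cases k)
    case (Suc j)
    show ?thesis unfolding Suc
      by (rule Ck_on_SucI[OF \<open>open U\<close> has_derivative_ident Ck_on_const])
  qed simp
qed

lemma smooth_on_linear:
  "open U \<Longrightarrow> bounded_linear h \<Longrightarrow> smooth_on U f \<Longrightarrow> smooth_on U (\<lambda>x. h (f x))"
  by (simp add: smooth_on_def Ck_on_linear)

lemma smooth_on_add:
  "open U \<Longrightarrow> smooth_on U f \<Longrightarrow> smooth_on U g \<Longrightarrow> smooth_on U (\<lambda>x. f x + g x)"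
  by (simp add: smooth_on_def Ck_on_add)

lemma smooth_on_bilinear:
  "open U \<Longrightarrow> bounded_bilinear h \<Longrightarrow> smooth_on U f \<Longrightarrow> smooth_on U g \<Longrightarrow> smooth_on U (\<lambda>x. h (f x) (g x))"
  by (simp add: smooth_on_def Ck_on_bilinear)

lemma smooth_on_compose:
  "open U \<Longrightarrow> open V \<Longrightarrow> g ` U \<subseteq> V \<Longrightarrow> smooth_on U g \<Longrightarrow> smooth_on V f \<Longrightarrow> smooth_on U (\<lambda>x. f (g x))"
  by (simp add: smooth_on_def Ck_on_compose)

lemma smooth_on_subset: "smooth_on U f \<Longrightarrow> V \<subseteq> U \<Longrightarrow> smooth_on V f"
  unfolding smooth_on_def by (blast intro: Ck_on_subset)

lemmas smooth_on_scaleR = smooth_on_bilinear[OF _ bounded_bilinear_scaleR]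
  and smooth_on_inner = smooth_on_bilinear[OF _ bounded_bilinear_inner]
  and smooth_on_fst = smooth_on_linear[OF _ bounded_linear_fst]
  and smooth_on_snd = smooth_on_linear[OF _ bounded_linear_snd]
  and smooth_on_minus = smooth_on_linear[OF _ bounded_linear_minus[OF bounded_linear_ident]]

lemma smooth_on_mult:
  fixes f g :: "'a::euclidean_space \<Rightarrow> real"
  shows "open U \<Longrightarrow> smooth_on U f \<Longrightarrow> smooth_on U g \<Longrightarrow> smooth_on U (\<lambda>x. f x * g x)"
  by (rule smooth_on_bilinear[OF _ bounded_bilinear_mult])

lemma smooth_on_diff:
  "open U \<Longrightarrow> smooth_on U f \<Longrightarrow> smooth_on U g \<Longrightarrow> smooth_on U (\<lambda>x. f x - g x)"
  using smooth_on_add[OF _ _ smooth_on_minus] by fastforce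

lemma smooth_on_Pair:
  fixes f :: "'a::euclidean_space \<Rightarrow> 'b::euclidean_space" and g :: "'a \<Rightarrow> 'c::euclidean_space"
  assumes "open U" "smooth_on U f" "smooth_on U g"
  shows "smooth_on U (\<lambda>x. (f x, g x))"
proof -
  have "smooth_on U (\<lambda>x. (f x, 0 :: 'c))" "smooth_on U (\<lambda>x. (0 :: 'b, g x))"
    using smooth_on_linear[OF assms(1) bounded_linear_Pair[OF bounded_linear_ident bounded_linear_zero] assms(2)]
      smooth_on_linear[OF assms(1) bounded_linear_Pair[OF bounded_linear_zero bounded_linear_ident] assms(3)]
    by auto
  from smooth_on_add[OF assms(1) this]
show ?thesis by simp
qed

text \<open>The exponent is kept general because differentiation lowers it by one; square roots and
  inverse square roots are the instances needed.\<close>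

lemma Ck_on_powr: "Ck_on k {0<..} (\<lambda>x::real. x powr a)"
proof (induction k arbitrary: a)
  case 0
  show ?case by (auto intro!: continuous_intros)
next
  case (Suc k)
  show ?case
    by (rule Ck_on_real[where f' = "\<lambda>x. a * x powr (a - 1)"])
      (auto intro!: Ck_on_linear[OF _ bounded_linear_mult_right] Suc derivative_eq_intros)
qed

lemma smooth_on_powr:
  fixes f :: "'a::euclidean_space \<Rightarrow> real"
  shows "open U \<Longrightarrow> smooth_on U f \<Longrightarrow> (\<And>x. x \<in> U \<Longrightarrow> f x > 0) \<Longrightarrow> smooth_on U (\<lambda>x. f x powr a)"
  by (rule smooth_on_compose[where V = "{0<..}" and f = "\<lambda>x. x powr a"]) (auto simp: smooth_on_def Ck_on_powr)

text \<open>The derivative of a shifted sine is the sine shifted by a further \<open>pi / 2\<close>,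
  so the family over all phases is closed under differentiation. The cosine comes out as one of its
  members.\<close>

lemma Ck_on_sin: "Ck_on k UNIV (\<lambda>x::real. sin (x + a))"
proof (induction k arbitrary: a)
  case 0
  show ?case by (auto intro!: continuous_intros)
next
  case (Suc k)
  show ?case
    by (rule Ck_on_real[OF _ _ Suc[of "a + pi/2"]])
     (auto intro!: derivative_eq_intros simp: add.assoc[symmetric] sin_add cos_add)
qed

lemma smooth_on_sin:
  fixes f :: "'a::euclidean_space \<Rightarrow> real"
  assumes "open U" "smooth_on U f"
  shows "smooth_on U (\<lambda>x. sin (f x))"
proof -
  have "smooth_on UNIV (\<lambda>x::real. sin x)"
    using Ck_on_sin[of _ 0] by (simp add: smooth_on_def)
  then show ?thesis
    using smooth_on_compose[OF assms(1) open_UNIV subset_UNIV assms(2)] by blast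
qed

lemma smooth_on_cos:
  fixes f :: "'a::euclidean_space \<Rightarrow> real"
  assumes "open U" "smooth_on U f"
  shows "smooth_on U (\<lambda>x. cos (f x))"
proof -
  have "smooth_on U (\<lambda>x. sin (f x + pi / 2))"
    by (rule smooth_on_sin[OF assms(1) smooth_on_add[OF assms smooth_on_const]])
  then show ?thesis by (simp add: sin_add)
qed

lemmas smooth_intros = smooth_on_const smooth_on_id smooth_on_add smooth_on_diff smooth_on_scaleR
  smooth_on_mult smooth_on_inner smooth_on_fst smooth_on_snd smooth_on_minus smooth_on_Pair
  smooth_on_sin smooth_on_cos

section \<open>Submanifolds, tangent spaces and traces\<close>

lemma smooth_on_imp_continuous_on: "smooth_on U f \<Longrightarrow> continuous_on U f"
  by (metis smooth_on_def Ck_on.simps(1))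

lemma smooth_on_imp_has_derivative:
  "smooth_on U f \<Longrightarrow> open U \<Longrightarrow> x \<in> U \<Longrightarrow> (f has_derivative frechet_derivative f (at x)) (at x)"
  unfolding smooth_on_def by (blast intro: Ck_on_SucD)

text \<open>Mutually inverse smooth maps already form a homeomorphism, so it is enough to give both
  maps and a pointwise membership criterion.\<close>

lemma smooth_submanifoldI:
  assumes "\<And>p. p \<in> S \<Longrightarrow> \<exists>U (V::'a set) \<phi> \<psi> L. open U \<and> p \<in> U \<and> open V \<and> \<phi> ` U \<subseteq> V \<and> \<psi> ` V \<subseteq> U \<and>
      (\<forall>x\<in>U. \<psi> (\<phi> x) = x) \<and> (\<forall>y\<in>V. \<phi> (\<psi> y) = y) \<and> smooth_on U \<phi> \<and> smooth_on V \<psi> \<and>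
      subspace L \<and> dim L = d \<and> (\<forall>x\<in>U. x \<in> S \<longleftrightarrow> \<phi> x \<in> L)"
  shows "smooth_submanifold d (S :: 'a::euclidean_space set)"
  unfolding smooth_submanifold_def
proof
  fix p assume "p \<in> S"
  from assms[OF this] obtain U and V :: "'a set" and \<phi> \<psi> L where *: "open U" "p \<in> U" "open V" "\<phi> ` U \<subseteq> V" "\<psi> ` V \<subseteq> U"
      "\<forall>x\<in>U. \<psi> (\<phi> x) = x" "\<forall>y\<in>V. \<phi> (\<psi> y) = y" "smooth_on U \<phi>" "smooth_on V \<psi>"
      "subspace L" "dim L = d" "\<forall>x\<in>U. x \<in> S \<longleftrightarrow> \<phi> x \<in> L" by blast
  then have h: "homeomorphism U V \<phi> \<psi>"
    by (intro homeomorphismI smooth_on_imp_continuous_on) auto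
  have im: "\<phi> ` (U \<inter> S) = V \<inter> L"
  proof (intro equalityI subsetI)
    fix y assume "y \<in> V \<inter> L"
    then have "y = \<phi> (\<psi> y)" "\<psi> y \<in> U \<inter> S" using * by auto
    then show "y \<in> \<phi> ` (U \<inter> S)" by blast
  qed (use * in auto)
  show "\<exists>U (V::'a set) \<phi> \<psi> L.
        open U \<and> p \<in> U \<and> open V \<and> homeomorphism U V \<phi> \<psi> \<and> smooth_on U \<phi> \<and> smooth_on V \<psi> \<and>
        subspace L \<and> dim L = d \<and> \<phi> ` (U \<inter> S) = V \<inter> L"
  proof (intro exI conjI)
    show "open U" "p \<in> U" "open V" by (fact *)+
    show "homeomorphism U V \<phi> \<psi>" by (fact h)
    show "smooth_on U \<phi>" "smooth_on V \<psi>" "subspace L" "dim L = d" by (fact *)+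
    show "\<phi> ` (U \<inter> S) = V \<inter> L" by (fact im)
  qed
qed

lemma smooth_submanifoldE:
  fixes S :: "'a::euclidean_space set"
  assumes "smooth_submanifold d S" "p \<in> S"
  obtains U and V :: "'a set" and \<phi> \<psi> L where "open U" "p \<in> U" "open V" "\<forall>x\<in>U. \<phi> x \<in> V" "\<forall>y\<in>V. \<psi> y \<in> U"
    "\<forall>x\<in>U. \<psi> (\<phi> x) = x" "\<forall>y\<in>V. \<phi> (\<psi> y) = y" "smooth_on U \<phi>" "smooth_on V \<psi>"
    "subspace L" "dim L = d" "\<forall>x\<in>U. x \<in> S \<longleftrightarrow> \<phi> x \<in> L"
proof -
  from assms(1)[unfolded smooth_submanifold_def, rule_format, OF assms(2)] obtain U and V :: "'a set" and \<phi> \<psi> L where *: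
    "open U" "p \<in> U" "open V" and h: "homeomorphism U V \<phi> \<psi>" and
    sm: "smooth_on U \<phi>" "smooth_on V \<psi>" "subspace L" "dim L = d" and S: "\<phi> ` (U \<inter> S) = V \<inter> L"
    by - (elim exE conjE, rule that)
  have inv: "\<forall>x\<in>U. \<phi> x \<in> V" "\<forall>y\<in>V. \<psi> y \<in> U"
    "\<forall>x\<in>U. \<psi> (\<phi> x) = x" "\<forall>y\<in>V. \<phi> (\<psi> y) = y"
    using h by (auto simp: homeomorphism_def)
  moreover have "x \<in> S \<longleftrightarrow> \<phi> x \<in> L" if "x \<in> U" for x
  proof
    assume "x \<in> S"
    then have "\<phi> x \<in> \<phi> ` (U \<inter> S)" using that by blast
    then show "\<phi> x \<in> L" using S by simp
  next
    assume "\<phi> x \<in> L"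
    then have "\<phi> x \<in> \<phi> ` (U \<inter> S)" using S inv(1)[rule_format, OF that] by simp
    then obtain z where "z \<in> U" "z \<in> S" "\<phi> x = \<phi> z" by blast
    then show "x \<in> S" by (metis inv(3) that)
  qed
  ultimately show thesis using * sm by (intro that[of U V \<phi> \<psi> L]) auto
qed

lemma smooth_submanifold_UNIV: "smooth_submanifold DIM('a) (UNIV :: 'a::euclidean_space set)"
  by (rule smooth_submanifoldI, rule exI[of _ UNIV], rule exI[of _ UNIV], rule exI[of _ "\<lambda>x. x"],
      rule exI[of _ "\<lambda>x. x"], rule exI[of _ UNIV]) (auto intro: smooth_intros simp: dim_UNIV)

lemma smooth_submanifold_singleton: "smooth_submanifold 0 {t :: 'a::euclidean_space}"
  by (rule smooth_submanifoldI, rule exI[of _ UNIV], rule exI[of _ UNIV], rule exI[of _ "\<lambda>x. x - t"],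
      rule exI[of _ "\<lambda>x. x + t"], rule exI[of _ "{0}"]) (auto intro!: smooth_intros)

text \<open>Near \<open>p\<close>, the chart replaces the coordinate in the direction \<open>e\<close> of \<open>p\<close> by \<open>x \<bullet> x - r\<^sup>2\<close>.\<close>

lemma smooth_submanifold_sphere:
  assumes "r > 0"
  shows "smooth_submanifold (DIM('a) - 1) (sphere (0 :: 'a::euclidean_space) r)"
proof (rule smooth_submanifoldI)
  fix p :: 'a assume p: "p \<in> sphere 0 r"
  define e where "e = p /\<^sub>R r"
  have e: "e \<bullet> e = 1" "p \<bullet> e > 0"
    using p assms by (auto simp: e_def dot_square_norm power2_eq_square field_simps)
  \<comment> \<open>For \<open>y = \<phi> x\<close> the part orthogonal to \<open>e\<close> is that
    of \<open>x\<close>, and \<open>y \<bullet> e + r\<^sup>2\<close> is the squared norm of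
    \<open>x\<close>. Hence \<open>\<rho> y\<close> is the square of the lost coordinate
    \<open>x \<bullet> e\<close>, and \<open>\<psi>\<close> restores its positive root. The root is
    written with \<open>powr\<close> to make \<open>smooth_on_powr\<close> applicable.\<close>
  define \<rho> where "\<rho> y = r\<^sup>2 + y \<bullet> e - (y \<bullet> y - (y \<bullet> e) * (y \<bullet> e))" for y
  define U V where "U = {x. 0 < x \<bullet> e}" and "V = {y. 0 < \<rho> y}"
  define \<phi> where "\<phi> x = x + (x \<bullet> x - r\<^sup>2 - x \<bullet> e) *\<^sub>R e" for x
  define \<psi> where "\<psi> y = y + (\<rho> y powr (1/2) - y \<bullet> e) *\<^sub>R e" for y
  have oU: "open U" unfolding U_def by (intro open_Collect_less continuous_intros)
  have oV: "open V" unfolding V_def \<rho>_def by (intro open_Collect_less continuous_intros)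
  have \<phi>e: "\<phi> x \<bullet> e = x \<bullet> x - r\<^sup>2" for x
    by (simp add: \<phi>_def inner_add_left e)
  have perp: "(x + c *\<^sub>R e) \<bullet> (x + c *\<^sub>R e) - ((x + c *\<^sub>R e) \<bullet> e) * ((x + c *\<^sub>R e) \<bullet> e)
      = x \<bullet> x - (x \<bullet> e) * (x \<bullet> e)" for x c
  proof -
    have xx: "(x + c *\<^sub>R e) \<bullet> (x + c *\<^sub>R e) = x \<bullet> x + 2 * c * (x \<bullet> e) + c * c"
      by (simp add: inner_add_left inner_add_right e inner_commute[of e x] distrib_left)
    have xe: "(x + c *\<^sub>R e) \<bullet> e = x \<bullet> e + c" by (simp add: inner_add_left e)
    show ?thesis unfolding xx xe by (simp add: algebra_simps)
  qed
  have \<rho>\<phi>: "\<rho> (\<phi> x) = (x \<bullet> e)\<^sup>2" for x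
    using perp[of x "x \<bullet> x - r\<^sup>2 - x \<bullet> e"] \<phi>e[of x]
    unfolding \<rho>_def \<phi>_def by (simp add: power2_eq_square)
  have \<psi>e: "\<psi> y \<bullet> e = sqrt (\<rho> y)" if "y \<in> V" for y
    using that by (simp add: \<psi>_def V_def inner_add_left e powr_half_sqrt)
  have \<psi>\<psi>: "\<psi> y \<bullet> \<psi> y - r\<^sup>2 = y \<bullet> e" if "y \<in> V" for y
  proof -
    have "\<psi> y \<bullet> \<psi> y - (\<psi> y \<bullet> e) * (\<psi> y \<bullet> e) = y \<bullet> y - (y \<bullet> e) * (y \<bullet> e)"
      unfolding \<psi>_def by (rule perp)
    moreover have "(\<psi> y \<bullet> e) * (\<psi> y \<bullet> e) = \<rho> y"
      using that by (simp add: \<psi>e V_def)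
    ultimately show ?thesis by (simp add: \<rho>_def)
  qed
  show "\<exists>U (V::'a set) \<phi> \<psi> L. open U \<and> p \<in> U \<and> open V \<and> \<phi> ` U \<subseteq> V \<and> \<psi> ` V \<subseteq> U \<and>
      (\<forall>x\<in>U. \<psi> (\<phi> x) = x) \<and> (\<forall>y\<in>V. \<phi> (\<psi> y) = y) \<and> smooth_on U \<phi> \<and> smooth_on V \<psi> \<and>
      subspace L \<and> dim L = DIM('a) - 1 \<and> (\<forall>x\<in>U. x \<in> sphere 0 r \<longleftrightarrow> \<phi> x \<in> L)"
  proof (intro exI conjI ballI)
    show "open U" "open V" "p \<in> U" using oU oV e by (auto simp: U_def)
    show "\<phi> ` U \<subseteq> V" by (auto simp: U_def V_def \<rho>\<phi>)
    show "\<psi> ` V \<subseteq> U" using \<psi>e by (auto simp: U_def) (auto simp: V_def)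
    show "\<psi> (\<phi> x) = x" if "x \<in> U" for x
    proof -
      have "\<psi> (\<phi> x) = \<phi> x + (x \<bullet> e - (x \<bullet> x - r\<^sup>2)) *\<^sub>R e"
        using that by (simp add: \<psi>_def \<rho>\<phi> \<phi>e U_def powr_half_sqrt)
      then show ?thesis by (simp add: \<phi>_def algebra_simps)
    qed
    show "\<phi> (\<psi> y) = y" if "y \<in> V" for y
    proof -
      have "\<phi> (\<psi> y) = \<psi> y + (y \<bullet> e - sqrt (\<rho> y)) *\<^sub>R e"
        using that by (simp add: \<phi>_def \<psi>\<psi> \<psi>e)
      then show ?thesis using that by (simp add: \<psi>_def powr_half_sqrt V_def algebra_simps)
    qed
    show "smooth_on U \<phi>" unfolding \<phi>_def by (intro smooth_intros oU)
    show "smooth_on V \<psi>" unfolding \<psi>_def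
    proof (intro smooth_intros smooth_on_powr oV)
      show "smooth_on V \<rho>" unfolding \<rho>_def by (intro smooth_intros oV)
    qed (auto simp: V_def)
    show "subspace {x. e \<bullet> x = 0}" by (rule subspace_hyperplane)
    show "dim {x. e \<bullet> x = 0} = DIM('a) - 1" using e by (intro dim_hyperplane) auto
    show "x \<in> sphere 0 r \<longleftrightarrow> \<phi> x \<in> {x. e \<bullet> x = 0}" for x
      using assms by (simp add: inner_commute[of e] \<phi>e dot_square_norm power2_eq_iff_nonneg)
  qed
qed

lemma smooth_submanifold_Times:
  fixes S :: "'a::euclidean_space set" and S' :: "'b::euclidean_space set"
  assumes "smooth_submanifold d S" "smooth_submanifold d' S'"
  shows "smooth_submanifold (d + d') (S \<times> S')"
proof (rule smooth_submanifoldI)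
  fix z assume "z \<in> S \<times> S'"
  then obtain p p' where z: "z = (p, p')" "p \<in> S" "p' \<in> S'" by auto
  obtain U and V :: "'a set" and \<phi> \<psi> L where
    1: "open U" "p \<in> U" "open V" "\<forall>x\<in>U. \<phi> x \<in> V" "\<forall>y\<in>V. \<psi> y \<in> U"
    "\<forall>x\<in>U. \<psi> (\<phi> x) = x" "\<forall>y\<in>V. \<phi> (\<psi> y) = y" "smooth_on U \<phi>" "smooth_on V \<psi>"
    "subspace L" "dim L = d" "\<forall>x\<in>U. x \<in> S \<longleftrightarrow> \<phi> x \<in> L"
    by (rule smooth_submanifoldE[OF assms(1) z(2)])
  obtain U' and V' :: "'b set" and \<phi>' \<psi>' L' where
    2: "open U'" "p' \<in> U'" "open V'" "\<forall>x\<in>U'. \<phi>' x \<in> V'" "\<forall>y\<in>V'. \<psi>' y \<in> U'"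
    "\<forall>x\<in>U'. \<psi>' (\<phi>' x) = x" "\<forall>y\<in>V'. \<phi>' (\<psi>' y) = y" "smooth_on U' \<phi>'" "smooth_on V' \<psi>'"
    "subspace L'" "dim L' = d'" "\<forall>x\<in>U'. x \<in> S' \<longleftrightarrow> \<phi>' x \<in> L'"
    by (rule smooth_submanifoldE[OF assms(2) z(3)])
  have sm: "smooth_on (A \<times> A') (\<lambda>x. (f (fst x), f' (snd x)))"
    if "open A" "open A'" "smooth_on A f" "smooth_on A' f'"
    for A :: "'a set" and A' :: "'b set" and f :: "'a \<Rightarrow> 'a" and f' :: "'b \<Rightarrow> 'b"
  proof -
    have o: "open (A \<times> A')" using that by (simp add: open_Times)
    have "smooth_on (A \<times> A') (\<lambda>x. fst x)" "smooth_on (A \<times> A') (\<lambda>x. snd x)"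
      by (rule smooth_on_fst[OF o smooth_on_id[OF o]], rule smooth_on_snd[OF o smooth_on_id[OF o]])
    then show ?thesis
      using smooth_on_compose[OF o that(1) _ _ that(3), of fst] smooth_on_compose[OF o that(2) _ _ that(4), of snd]
      by (intro smooth_on_Pair[OF o]) auto
  qed
  show "\<exists>U (V::('a \<times> 'b) set) \<phi> \<psi> L. open U \<and> z \<in> U \<and> open V \<and> \<phi> ` U \<subseteq> V \<and> \<psi> ` V \<subseteq> U \<and>
      (\<forall>x\<in>U. \<psi> (\<phi> x) = x) \<and> (\<forall>y\<in>V. \<phi> (\<psi> y) = y) \<and> smooth_on U \<phi> \<and> smooth_on V \<psi> \<and>
      subspace L \<and> dim L = d + d' \<and> (\<forall>x\<in>U. x \<in> S \<times> S' \<longleftrightarrow> \<phi> x \<in> L)"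
  proof (intro exI conjI)
    show "open (U \<times> U')" "open (V \<times> V')" using 1 2 by (auto intro: open_Times)
    show "smooth_on (U \<times> U') (\<lambda>x. (\<phi> (fst x), \<phi>' (snd x)))"
      "smooth_on (V \<times> V') (\<lambda>x. (\<psi> (fst x), \<psi>' (snd x)))" using 1 2 by (auto intro: sm)
    show "subspace (L \<times> L')" using 1 2 by (auto intro: subspace_Times)
    show "dim (L \<times> L') = d + d'" using 1 2 by (simp add: dim_Times)
  qed (use 1 2 z in auto)
qed

text \<open>Slice charts of \<open>S\<close> are precomposed with the global diffeomorphism. This
  reduces the twisted surface to a product of spheres and a line.\<close>

lemma smooth_submanifold_vimage:
  fixes \<Phi> :: "'a::euclidean_space \<Rightarrow> 'a"
  assumes "smooth_submanifold d S" "smooth_on UNIV \<Phi>" "smooth_on UNIV \<Psi>"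
    and inv: "\<And>x. \<Psi> (\<Phi> x) = x" "\<And>x. \<Phi> (\<Psi> x) = x"
  shows "smooth_submanifold d (\<Phi> -` S)"
proof (rule smooth_submanifoldI)
  fix p assume "p \<in> \<Phi> -` S"
  then have \<Phi>p: "\<Phi> p \<in> S" by simp
  obtain U and V :: "'a set" and \<phi> \<psi> L where
    1: "open U" "\<Phi> p \<in> U" "open V" "\<forall>x\<in>U. \<phi> x \<in> V" "\<forall>y\<in>V. \<psi> y \<in> U"
    "\<forall>x\<in>U. \<psi> (\<phi> x) = x" "\<forall>y\<in>V. \<phi> (\<psi> y) = y" "smooth_on U \<phi>" "smooth_on V \<psi>"
    "subspace L" "dim L = d" "\<forall>x\<in>U. x \<in> S \<longleftrightarrow> \<phi> x \<in> L"
    by (rule smooth_submanifoldE[OF assms(1) \<Phi>p])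
  have o: "open (\<Phi> -` U)"
    using smooth_on_imp_continuous_on[OF assms(2)] 1(1) continuous_on_open_vimage[OF open_UNIV] by auto
  show "\<exists>U (V::'a set) \<phi> \<psi> L. open U \<and> p \<in> U \<and> open V \<and> \<phi> ` U \<subseteq> V \<and> \<psi> ` V \<subseteq> U \<and>
      (\<forall>x\<in>U. \<psi> (\<phi> x) = x) \<and> (\<forall>y\<in>V. \<phi> (\<psi> y) = y) \<and> smooth_on U \<phi> \<and> smooth_on V \<psi> \<and>
      subspace L \<and> dim L = d \<and> (\<forall>x\<in>U. x \<in> \<Phi> -` S \<longleftrightarrow> \<phi> x \<in> L)"
  proof (intro exI conjI)
    show "smooth_on (\<Phi> -` U) (\<lambda>x. \<phi> (\<Phi> x))"
      using smooth_on_compose[OF o 1(1) _ smooth_on_subset[OF assms(2) subset_UNIV] 1(8)] by blast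
    show "smooth_on V (\<lambda>x. \<Psi> (\<psi> x))"
      using smooth_on_compose[OF 1(3) open_UNIV subset_UNIV 1(9) assms(3)] .
  qed (use 1 o inv in auto)
qed

text \<open>Shrinking the charts to \<open>W\<close> suffices. It makes the spacelike region a
  hypersurface in its own right.\<close>

lemma smooth_submanifold_Int_open:
  assumes "smooth_submanifold d (S :: 'a::euclidean_space set)" "open W"
  shows "smooth_submanifold d (S \<inter> W)"
proof (rule smooth_submanifoldI)
  fix p assume "p \<in> S \<inter> W"
  then have p: "p \<in> S" "p \<in> W" by auto
  obtain U and V :: "'a set" and \<phi> \<psi> L where
    1: "open U" "p \<in> U" "open V" "\<forall>x\<in>U. \<phi> x \<in> V" "\<forall>y\<in>V. \<psi> y \<in> U"
    "\<forall>x\<in>U. \<psi> (\<phi> x) = x" "\<forall>y\<in>V. \<phi> (\<psi> y) = y" "smooth_on U \<phi>" "smooth_on V \<psi>"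
    "subspace L" "dim L = d" "\<forall>x\<in>U. x \<in> S \<longleftrightarrow> \<phi> x \<in> L"
    by (rule smooth_submanifoldE[OF assms(1) p(1)])
  have o: "open (V \<inter> \<psi> -` W)"
    using continuous_open_preimage[OF smooth_on_imp_continuous_on[OF 1(9)] 1(3) assms(2)] .
  show "\<exists>U (V::'a set) \<phi> \<psi> L. open U \<and> p \<in> U \<and> open V \<and> \<phi> ` U \<subseteq> V \<and> \<psi> ` V \<subseteq> U \<and>
      (\<forall>x\<in>U. \<psi> (\<phi> x) = x) \<and> (\<forall>y\<in>V. \<phi> (\<psi> y) = y) \<and> smooth_on U \<phi> \<and> smooth_on V \<psi> \<and>
      subspace L \<and> dim L = d \<and> (\<forall>x\<in>U. x \<in> S \<inter> W \<longleftrightarrow> \<phi> x \<in> L)"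
  proof (intro exI conjI)
    show "open (U \<inter> W)" using 1 assms(2) by auto
    show "smooth_on (U \<inter> W) \<phi>" "smooth_on (V \<inter> \<psi> -` W) \<psi>" using 1 by (auto intro: smooth_on_subset)
    show "\<phi> ` (U \<inter> W) \<subseteq> V \<inter> \<psi> -` W" "\<psi> ` (V \<inter> \<psi> -` W) \<subseteq> U \<inter> W" using 1 by auto
    show "\<forall>x\<in>U \<inter> W. (x \<in> S \<inter> W) = (\<phi> x \<in> L)" using 1 by auto
    show "open (V \<inter> \<psi> -` W)" by (rule o)
  qed (use 1 p in auto)
qed

section \<open>Curves, tangent vectors and derivatives along a submanifold\<close>

lemma curve_through_has_vector_derivative:
  assumes "curve_through S p v \<gamma>" "(g has_derivative g') (at p)"
  shows "((g \<circ> \<gamma>) has_vector_derivative g' v) (at 0)"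
proof -
  have "\<gamma> 0 = p" "(\<gamma> has_derivative (\<lambda>x. x *\<^sub>R v)) (at 0)"
    using assms(1) by (auto simp: curve_through_def has_vector_derivative_def)
  then have "((g \<circ> \<gamma>) has_derivative (\<lambda>x. g' (x *\<^sub>R v))) (at 0)"
    using has_derivative_compose[of \<gamma> _ 0 UNIV g g'] assms(2) by (simp add: o_def)
  then show ?thesis
    by (simp add: has_vector_derivative_def linear_cmul[OF has_derivative_linear[OF assms(2)]])
qed

text \<open>By the chain rule every admissible curve yields the same value, so the definite
  description denotes. Derivatives along \<open>S\<close> thus become Frechet derivatives of ambient
  maps.\<close>

lemma deriv_along_eq:
  assumes "v \<in> tangent_space S p" "(g has_derivative g') (at p)"
  shows "deriv_along S g p v = g' v"
  unfolding deriv_along_def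
proof (rule the_equality)
  show "\<exists>\<gamma>. curve_through S p v \<gamma> \<and> ((g \<circ> \<gamma>) has_vector_derivative g' v) (at 0)"
    using assms curve_through_has_vector_derivative unfolding tangent_space_def by blast
  show "w = g' v" if "\<exists>\<gamma>. curve_through S p v \<gamma> \<and> ((g \<circ> \<gamma>) has_vector_derivative w) (at 0)" for w
    using that assms(2) curve_through_has_vector_derivative vector_derivative_unique_at by blast
qed

text \<open>Along a curve in \<open>S\<close> the map is constant, so its derivative vanishes.
  Applied to defining equations this bounds tangent spaces from above.\<close>

lemma tangent_space_const_on:
  assumes "v \<in> tangent_space S p" "(g has_derivative g') (at p)" "\<And>x. x \<in> S \<Longrightarrow> g x = c"
  shows "g' v = 0"
proof -
  obtain \<gamma> where \<gamma>: "curve_through S p v \<gamma>" using assms(1) by (auto simp: tangent_space_def)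
  then obtain \<epsilon> where "\<epsilon> > 0" "\<gamma> ` {-\<epsilon><..<\<epsilon>} \<subseteq> S" by (auto simp: curve_through_def)
  then have "((g \<circ> \<gamma>) has_vector_derivative 0) (at 0)"
    using assms(3)
    by (intro has_vector_derivative_transform_within_open[OF has_vector_derivative_const[of c], of "{-\<epsilon><..<\<epsilon>}"])
      (auto simp: image_subset_iff)
  then show ?thesis
    using curve_through_has_vector_derivative[OF \<gamma> assms(2)] vector_derivative_unique_at by blast
qed

text \<open>Straight lines in the slice of a chart, carried back by \<open>\<psi>\<close>, show that
  the tangent space contains a linear subspace of dimension \<open>d\<close>. A subspace
  \<open>V\<close> of that dimension above the tangent space must then coincide with both.\<close>

lemma tangent_space_eqI:
  assumes "smooth_submanifold d (S :: 'a::euclidean_space set)" "p \<in> S" "tangent_space S p \<subseteq> V" "subspace V" "dim V = d"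
  shows "tangent_space S p = V"
proof -
  obtain U and W :: "'a set" and \<phi> \<psi> L where
    1: "open U" "p \<in> U" "open W" "\<forall>x\<in>U. \<phi> x \<in> W" "\<forall>y\<in>W. \<psi> y \<in> U"
    "\<forall>x\<in>U. \<psi> (\<phi> x) = x" "\<forall>y\<in>W. \<phi> (\<psi> y) = y" "smooth_on U \<phi>" "smooth_on W \<psi>"
    "subspace L" "dim L = d" "\<forall>x\<in>U. x \<in> S \<longleftrightarrow> \<phi> x \<in> L"
    by (rule smooth_submanifoldE[OF assms(1,2)])
  let ?\<psi>' = "frechet_derivative \<psi> (at (\<phi> p))" and ?\<phi>' = "frechet_derivative \<phi> (at p)"
  have d\<psi>: "(\<psi> has_derivative ?\<psi>') (at (\<phi> p))"
    using 1 by (intro smooth_on_imp_has_derivative[OF 1(9)]) auto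
  have d\<phi>: "(\<phi> has_derivative ?\<phi>') (at p)"
    using 1 by (intro smooth_on_imp_has_derivative[OF 1(8)]) auto
  have lin: "linear ?\<psi>'" by (rule has_derivative_linear[OF d\<psi>])
  \<comment> \<open>Differentiating that \<open>\<phi>\<close> undoes \<open>\<psi>\<close> gives a
    left inverse of the derivative of \<open>\<psi>\<close>; its injectivity preserves the dimension
    of \<open>L\<close>.\<close>
  have "((\<lambda>y. \<phi> (\<psi> y)) has_derivative (\<lambda>v. ?\<phi>' (?\<psi>' v))) (at (\<phi> p))"
    using has_derivative_compose[OF d\<psi>, of \<phi> ?\<phi>'] d\<phi> 1 by simp
  then have "((\<lambda>y. y) has_derivative (\<lambda>v. ?\<phi>' (?\<psi>' v))) (at (\<phi> p))"
    using 1 by (elim has_derivative_transform_within_open[OF _ 1(3)]) auto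
  then have "(\<lambda>v. ?\<phi>' (?\<psi>' v)) = (\<lambda>v. v)"
    by (rule has_derivative_unique[OF _ has_derivative_ident])
  then have inj: "inj ?\<psi>'" by (metis injI)
  have sub: "?\<psi>' ` L \<subseteq> tangent_space S p"
  proof
    fix v assume "v \<in> ?\<psi>' ` L"
    then obtain l where l: "l \<in> L" "v = ?\<psi>' l" by auto
    obtain e where e: "e > 0" "ball (\<phi> p) e \<subseteq> W"
      using 1 open_contains_ball by metis
    \<comment> \<open>The line stays in the ball of radius \<open>e\<close> for these parameters;
      the added \<open>1\<close> covers \<open>l = 0\<close>.\<close>
    define \<epsilon> where "\<epsilon> = e / (norm l + 1)"
    have \<epsilon>: "\<epsilon> > 0" using e by (simp add: \<epsilon>_def add_nonneg_pos)
    have W: "\<phi> p + s *\<^sub>R l \<in> W" if "s \<in> {-\<epsilon><..<\<epsilon>}" for s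
    proof -
      have "norm (s *\<^sub>R l) \<le> \<bar>s\<bar> * (norm l + 1)" by (simp add: mult_left_mono)
      also have "\<dots> < \<epsilon> * (norm l + 1)" using that by (intro mult_strict_right_mono) (auto simp: add_nonneg_pos)
      also have "\<dots> = e" by (simp add: \<epsilon>_def add_nonneg_eq_0_iff)
      finally show ?thesis using e by (auto simp: dist_norm)
    qed
    have "curve_through S p v (\<lambda>s. \<psi> (\<phi> p + s *\<^sub>R l))"
      unfolding curve_through_def
    proof (intro conjI exI[of _ \<epsilon>])
      show "smooth_on {-\<epsilon><..<\<epsilon>} (\<lambda>s. \<psi> (\<phi> p + s *\<^sub>R l))"
        using W by (intro smooth_on_compose[OF _ 1(3) _ _ 1(9)] smooth_intros) auto
      have "\<phi> p \<in> L" using 1 assms(2) by blast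
      then show "(\<lambda>s. \<psi> (\<phi> p + s *\<^sub>R l)) ` {-\<epsilon><..<\<epsilon>} \<subseteq> S"
        using W 1 l by (auto simp: subspace_add subspace_scale)
      have "((\<lambda>s. \<psi> (\<phi> p + s *\<^sub>R l)) has_derivative (\<lambda>s. ?\<psi>' (s *\<^sub>R l))) (at 0)"
        by (rule has_derivative_compose[of "\<lambda>s. \<phi> p + s *\<^sub>R l" _ _ _ \<psi>])
          (auto intro!: derivative_eq_intros d\<psi>)
      then show "((\<lambda>s. \<psi> (\<phi> p + s *\<^sub>R l)) has_vector_derivative v) (at 0)"
        by (simp add: has_vector_derivative_def linear_cmul[OF lin] l)
    qed (use \<epsilon> 1 in auto)
    then show "v \<in> tangent_space S p" by (auto simp: tangent_space_def)
  qed
  have "dim (?\<psi>' ` L) = d"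
    using dim_image_eq[OF lin, of L] inj 1 by (metis inj_on_subset subset_UNIV)
  then have "?\<psi>' ` L = V"
    using sub assms 1 lin by (intro subspace_dim_equal linear_subspace_image) auto
  then show ?thesis using sub assms(3) by blast
qed

section \<open>Projections, gradients and traces on subspaces\<close>

lemma orth_proj_eqI:
  assumes "subspace V" "u \<in> V" "\<And>v. v \<in> V \<Longrightarrow> (w - u) \<bullet> v = 0"
  shows "orth_proj V w = u"
  unfolding orth_proj_def
proof (rule the_equality)
  fix u' assume u': "u' \<in> V \<and> (\<forall>v\<in>V. (w - u') \<bullet> v = 0)"
  then have "u' - u \<in> V" using assms by (simp add: subspace_diff)
  then have "(w - u') \<bullet> (u' - u) = 0" "(w - u) \<bullet> (u' - u) = 0" using u' assms by auto
  then have "(u' - u) \<bullet> (u' - u) = 0" by (simp add: inner_diff_left)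
  then show "u' = u" by simp
qed (use assms in auto)

lemma gradient_eqI:
  assumes "subspace (tangent_space S p)" "g \<in> tangent_space S p" "(f has_derivative f') (at p)"
    and "\<And>X. X \<in> tangent_space S p \<Longrightarrow> g \<bullet> X = f' X"
  shows "gradient S f p = g"
  unfolding gradient_def
proof (rule the_equality)
  have *: "g \<bullet> X = deriv_along S f p X" if "X \<in> tangent_space S p" for X
    using assms that by (simp add: deriv_along_eq)
  then show "g \<in> tangent_space S p \<and> (\<forall>X\<in>tangent_space S p. g \<bullet> X = deriv_along S f p X)"
    using assms by blast
  fix h assume h: "h \<in> tangent_space S p \<and> (\<forall>X\<in>tangent_space S p. h \<bullet> X = deriv_along S f p X)"
  then have "(h - g) \<bullet> (h - g) = 0"
    using * assms by (simp add: inner_diff_left subspace_diff)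
  then show "h = g" by simp
qed

text \<open>Basis independence of the trace: each \<open>b\<close> is expanded in the chosen basis
  \<open>C\<close>, each \<open>T c\<close> in the orthonormal \<open>B\<close>, and the two sums
  are exchanged. \<open>T\<close> is the compression to \<open>V\<close> of a linear
  \<open>L\<close> on the whole space, and linearity is taken from \<open>L\<close> only.\<close>

lemma trace_on_eq_orthonormal:
  fixes L :: "'a::euclidean_space \<Rightarrow> 'a"
  assumes B: "finite B" "pairwise orthogonal B" "\<And>b. b \<in> B \<Longrightarrow> norm b = 1" "span B = V"
    and T: "\<And>x. x \<in> V \<Longrightarrow> T x \<in> V" "\<And>x y. x \<in> V \<Longrightarrow> y \<in> V \<Longrightarrow> T x \<bullet> y = L x \<bullet> y"
    and L: "linear L"
  shows "trace_on V T = (\<Sum>b\<in>B. L b \<bullet> b)"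
proof -
  have bb: "b \<bullet> b' = (if b = b' then 1 else 0)" if "b \<in> B" "b' \<in> B" for b b'
    using B that by (auto simp: pairwise_def orthogonal_def norm_eq_1)
  have BV: "b \<in> V" if "b \<in> B" for b using B(4) that span_base by auto
  have exp: "(\<Sum>b\<in>B. (x \<bullet> b) *\<^sub>R b) = x" if x: "x \<in> V" for x
  proof -
    obtain u where u: "x = (\<Sum>b\<in>B. u b *\<^sub>R b)"
      using x unfolding B(4)[symmetric] span_finite[OF B(1)] by blast
    have "x \<bullet> b = u b" if "b \<in> B" for b
    proof -
      have "x \<bullet> b = (\<Sum>c\<in>B. u c * (c \<bullet> b))" by (simp add: u inner_sum_left)
      also have "\<dots> = (\<Sum>c\<in>B. if c = b then u c else 0)"
        by (rule sum.cong) (auto simp: bb that)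
      also have "\<dots> = u b" using B(1) that by simp
      finally show ?thesis .
    qed
    then show ?thesis by (simp add: u)
  qed
  define C where "C = (SOME C. independent C \<and> span C = V)"
  have "\<exists>C. independent C \<and> span C = V"
    using orthonormal_basis_subspace[OF subspace_span[of B]] B(4) by metis
  then have C: "independent C" "span C = V"
    using someI_ex[of "\<lambda>C. independent C \<and> span C = V"] unfolding C_def by blast+
  have CV: "c \<in> V" if "c \<in> C" for c using C(2) that span_base by auto
  have finC: "finite C" using C(1) by (rule independent_imp_finite)
  have repr: "(\<Sum>c\<in>C. representation C x c *\<^sub>R c) = x" if "x \<in> V" for x
    using that C finC by (intro sum_representation_eq) auto
  have "(\<Sum>b\<in>B. L b \<bullet> b) = (\<Sum>b\<in>B. L (\<Sum>c\<in>C. representation C b c *\<^sub>R c) \<bullet> b)"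
    by (intro sum.cong) (auto simp: repr BV)
  also have "\<dots> = (\<Sum>b\<in>B. \<Sum>c\<in>C. representation C b c * (L c \<bullet> b))"
    by (simp add: linear_sum[OF L] linear_cmul[OF L] inner_sum_left)
  also have "\<dots> = (\<Sum>c\<in>C. \<Sum>b\<in>B. (T c \<bullet> b) * representation C b c)"
    by (subst sum.swap) (simp add: T(2) CV BV mult.commute)
  also have "\<dots> = (\<Sum>c\<in>C. representation C (\<Sum>b\<in>B. (T c \<bullet> b) *\<^sub>R b) c)"
  proof (rule sum.cong[OF refl])
    fix c
    have "representation C (\<Sum>b\<in>B. (T c \<bullet> b) *\<^sub>R b) = (\<lambda>d. \<Sum>b\<in>B. representation C ((T c \<bullet> b) *\<^sub>R b) d)"
      using C BV by (intro representation_sum) (auto intro!: span_scale)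
    then show "(\<Sum>b\<in>B. (T c \<bullet> b) * representation C b c) = representation C (\<Sum>b\<in>B. (T c \<bullet> b) *\<^sub>R b) c"
      using C BV by (simp add: representation_scale)
  qed
  also have "\<dots> = (\<Sum>c\<in>C. representation C (T c) c)"
    by (intro sum.cong) (auto simp: exp T CV)
  also have "\<dots> = trace_on V T" by (simp add: trace_on_def C_def Let_def)
  finally show ?thesis ..
qed

text \<open>An orthonormal basis of \<open>V\<close> together with \<open>N\<close> is one of the
  whole space, so the trace on \<open>V\<close> is the full trace minus the normal contributions.
  Mean curvatures can then be computed without a tangent frame.\<close>

lemma trace_on_orthogonal_complement:
  fixes L :: "'a::euclidean_space \<Rightarrow> 'a"
  assumes N: "finite N" "pairwise orthogonal N" "\<And>n. n \<in> N \<Longrightarrow> norm n = 1"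
    and V: "V = {v. \<forall>n\<in>N. v \<bullet> n = 0}"
    and T: "\<And>x. x \<in> V \<Longrightarrow> T x \<in> V" "\<And>x y. x \<in> V \<Longrightarrow> y \<in> V \<Longrightarrow> T x \<bullet> y = L x \<bullet> y"
    and L: "linear L"
  shows "trace_on V T = (\<Sum>e\<in>Basis. L e \<bullet> e) - (\<Sum>n\<in>N. L n \<bullet> n)"
proof -
  have "subspace V" by (auto simp: V subspace_def inner_add_left)
  then obtain B where B: "B \<subseteq> V" "pairwise orthogonal B" "\<forall>x\<in>B. norm x = 1"
      "independent B" "span B = V"
    by (rule orthonormal_basis_subspace, intro that) auto
  have finB: "finite B" using B(4) by (rule independent_imp_finite)
  have disj: "B \<inter> N = {}" using B(1,3) V by force
  have "b \<bullet> n = 0" "n \<bullet> b = 0" if "b \<in> B" "n \<in> N" for b n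
    using B(1) V that by (auto simp: inner_commute[of n])
  then have orth: "pairwise orthogonal (B \<union> N)"
    using B(2) N(2) by (simp add: pairwise_def orthogonal_def) blast
  have "x \<in> span (B \<union> N)" for x
  proof -
    let ?y = "\<Sum>n\<in>N. (x \<bullet> n) *\<^sub>R n"
    have "?y \<bullet> m = x \<bullet> m" if "m \<in> N" for m
    proof -
      have "?y \<bullet> m = (\<Sum>n\<in>N. if n = m then x \<bullet> n else 0)"
        unfolding inner_sum_left using N that
        by (intro sum.cong) (auto simp: pairwise_def orthogonal_def norm_eq_1)
      then show ?thesis using N(1) that by simp
    qed
    then have "x - ?y \<in> span B" by (simp add: B(5) V inner_diff_left)
    then have "x - ?y \<in> span (B \<union> N)" using span_mono by blast
    moreover have "?y \<in> span (B \<union> N)" by (intro span_sum span_scale span_base) auto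
    ultimately show ?thesis using span_add by fastforce
  qed
  \<comment> \<open>The full trace is evaluated twice, in the adapted basis and in the standard
    one.\<close>
  then have "trace_on UNIV L = (\<Sum>b\<in>B \<union> N. L b \<bullet> b)"
    using finB N B L orth by (intro trace_on_eq_orthonormal) auto
  moreover have "trace_on UNIV L = (\<Sum>e\<in>Basis. L e \<bullet> e)"
    using L by (intro trace_on_eq_orthonormal) (auto simp: pairwise_def orthogonal_def inner_Basis)
  moreover have "trace_on V T = (\<Sum>b\<in>B. L b \<bullet> b)"
    using finB B T L by (intro trace_on_eq_orthonormal) auto
  ultimately show ?thesis using disj finB N(1) by (simp add: sum.union_disjoint)
qed

lemma dim_orthogonal_complement:
  fixes N :: "'a::euclidean_space set"
  assumes "finite N" "pairwise orthogonal N" "0 \<notin> N"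
  shows "dim {v. \<forall>n\<in>N. v \<bullet> n = 0} = DIM('a) - card N"
proof -
  have "{y \<in> UNIV. \<forall>x\<in>span N. orthogonal x y} = {v. \<forall>n\<in>N. v \<bullet> n = 0}"
  proof (intro Collect_eqI iffI conjI ballI UNIV_I)
    fix y x assume *: "\<forall>n\<in>N. y \<bullet> n = 0" "x \<in> span N"
    then show "orthogonal x y"
      using orthogonal_to_span[of x N y] by (auto simp: orthogonal_def inner_commute)
  qed (auto simp: orthogonal_def span_base inner_commute)
  moreover have "dim (span N) = card N"
    using dim_eq_card_independent[OF pairwise_orthogonal_independent[OF assms(2,3)]] by simp
  moreover have "dim {y \<in> UNIV. \<forall>x\<in>span N. orthogonal x y} + dim (span N) = dim (UNIV :: 'a set)"
    by (rule dim_subspace_orthogonal_to_vectors) auto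
  ultimately show ?thesis by (simp add: dim_UNIV)
qed

section \<open>The twisted Clifford torus\<close>

text \<open>With pairs read as complex vectors, \<open>mirror \<alpha> z = e\<^sup>\<i>\<^sup>\<alpha> cnj z\<close> and \<open>rotation \<theta> z = e\<^sup>\<i>\<^sup>\<theta> z\<close>.\<close>

definition mirror :: "real \<Rightarrow> 'b::euclidean_space \<times> 'b \<Rightarrow> 'b \<times> 'b" where
  "mirror \<alpha> z = (cos \<alpha> *\<^sub>R fst z + sin \<alpha> *\<^sub>R snd z, sin \<alpha> *\<^sub>R fst z - cos \<alpha> *\<^sub>R snd z)"

definition rotation :: "real \<Rightarrow> 'b::euclidean_space \<times> 'b \<Rightarrow> 'b \<times> 'b" where
  "rotation \<theta> z = (cos \<theta> *\<^sub>R fst z - sin \<theta> *\<^sub>R snd z, sin \<theta> *\<^sub>R fst z + cos \<theta> *\<^sub>R snd z)"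

lemma bounded_linear_mirror: "bounded_linear (mirror \<alpha>)"
  unfolding mirror_def [abs_def]
  by (intro bounded_linear_Pair bounded_linear_add bounded_linear_sub bounded_linear_scaleR_right
      bounded_linear_const_scaleR bounded_linear_fst bounded_linear_snd)

lemma inner_mirror: "mirror \<alpha> z \<bullet> w = z \<bullet> mirror \<alpha> w"
  by (simp add: mirror_def inner_prod_def inner_add_left inner_add_right inner_diff_left inner_diff_right)

lemma mirror_mirror: "mirror \<alpha> (mirror \<alpha> z) = z"
proof -
  have "cos \<alpha> *\<^sub>R cos \<alpha> *\<^sub>R x + sin \<alpha> *\<^sub>R sin \<alpha> *\<^sub>R x = x" for x :: 'a
    by (metis scaleR_add_left scaleR_one scaleR_scaleR sin_cos_squared_add3)
  then show ?thesis
    by (simp add: mirror_def prod_eq_iff scaleR_add_right scaleR_diff_right mult.commute add.commute)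
qed

text \<open>The shift by \<open>pi / 2\<close> multiplies by the complex unit i, and i w is
  orthogonal to w for the real inner product.\<close>

lemma mirror_shift_orthogonal: "mirror (\<alpha> + pi / 2) z \<bullet> mirror \<alpha> z = 0"
  by (simp add: mirror_def inner_prod_def cos_add sin_add inner_add_left inner_add_right
      inner_diff_left inner_diff_right inner_commute[of "snd z" "fst z"] algebra_simps)

lemma sum_Basis_prod:
  fixes f :: "'a::euclidean_space \<times> 'b::euclidean_space \<Rightarrow> 'c::comm_monoid_add"
  shows "sum f Basis = (\<Sum>i\<in>Basis. f (i, 0)) + (\<Sum>i\<in>Basis. f (0, i))"
proof -
  have "inj_on (\<lambda>u. (u::'a, 0::'b)) Basis" "inj_on (\<lambda>u. (0::'a, u::'b)) Basis"
    by (auto intro!: inj_onI)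
  then show ?thesis
    unfolding Basis_prod_def
    by (subst sum.union_disjoint) (auto simp: sum.reindex Basis_prod_def)
qed

text \<open>The two factors contribute \<open>cos \<alpha>\<close> and \<open>- cos \<alpha>\<close>
  per basis vector.\<close>

lemma trace_mirror: "(\<Sum>e\<in>Basis. mirror \<alpha> e \<bullet> e) = 0"
  by (simp add: sum_Basis_prod mirror_def inner_prod_def sum_negf)

text \<open>In complex notation both sides are the real part of the bilinear square of w, where w is
  z multiplied by the unit number of angle \<open>- \<theta>\<close>. The right side is the defining
  expression of the Clifford torus at w.\<close>

lemma mirror_double_angle:
  "mirror (2 * \<theta>) z \<bullet> z =
     fst (rotation (- \<theta>) z) \<bullet> fst (rotation (- \<theta>) z) - snd (rotation (- \<theta>) z) \<bullet> snd (rotation (- \<theta>) z)"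
  unfolding mirror_def cos_double sin_double
  by (simp add: rotation_def inner_prod_def inner_add_left inner_add_right
      inner_diff_left inner_diff_right inner_commute power2_eq_square algebra_simps)

lemma rotation_rotation: "rotation \<theta> (rotation (- \<theta>) z) = z"
proof -
  have "cos \<theta> *\<^sub>R cos \<theta> *\<^sub>R x + sin \<theta> *\<^sub>R sin \<theta> *\<^sub>R x = x" for x :: 'a
    by (metis scaleR_add_left scaleR_one scaleR_scaleR sin_cos_squared_add3)
  then show ?thesis
    by (simp add: rotation_def prod_eq_iff scaleR_add_right scaleR_diff_right mult.commute add.commute)
qed

lemma norm_rotation: "norm (rotation \<theta> z) = norm z"
proof -
  have c: "cos \<theta> * cos \<theta> = 1 - sin \<theta> * sin \<theta>"
    using sin_cos_squared_add3[of \<theta>] by linarith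
  have "rotation \<theta> z \<bullet> rotation \<theta> z =
      (cos \<theta> * cos \<theta>) * (fst z \<bullet> fst z + snd z \<bullet> snd z) + (sin \<theta> * sin \<theta>) * (fst z \<bullet> fst z + snd z \<bullet> snd z)"
    by (simp add: rotation_def inner_prod_def inner_add_left inner_add_right
      inner_diff_left inner_diff_right inner_commute algebra_simps)
  also have "\<dots> = z \<bullet> z" unfolding c by (simp add: inner_prod_def algebra_simps)
  finally show ?thesis by (simp add: norm_eq_sqrt_inner)
qed

definition twisted :: "real \<Rightarrow> (('b::euclidean_space \<times> 'b) \<times> real) set" where
  "twisted c = {p. norm (fst p) = 1 \<and> mirror (2 * c * snd p) (fst p) \<bullet> fst p = 0}"

text \<open>This is G of the outline: the height derivative of the second equation of
  \<open>twisted c\<close> is \<open>2 * c\<close> times it.\<close>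

definition swirl :: "real \<Rightarrow> ('b::euclidean_space \<times> 'b) \<times> real \<Rightarrow> real" where
  "swirl c p = mirror (2 * c * snd p + pi / 2) (fst p) \<bullet> fst p"

text \<open>\<open>\<kappa> = 1\<close> gives a Riemannian normal of \<^term>\<open>twisted c\<close>, \<open>\<kappa> = - 1\<close> a Lorentzian one.\<close>

definition conormal :: "real \<Rightarrow> real \<Rightarrow> ('b::euclidean_space \<times> 'b) \<times> real \<Rightarrow> ('b \<times> 'b) \<times> real" where
  "conormal \<kappa> c p = (mirror (2 * c * snd p) (fst p), \<kappa> * c * swirl c p)"

text \<open>The radicand is positive at every point of the ambient space, so the normalised field is
  smooth off the surface as well.\<close>

definition twist_normal :: "real \<Rightarrow> ('b::euclidean_space \<times> 'b) \<times> real \<Rightarrow> ('b \<times> 'b) \<times> real" where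
  "twist_normal c p = (1 / sqrt (1 + (c * swirl c p)\<^sup>2)) *\<^sub>R conormal 1 c p"

text \<open>A global diffeomorphism with inverse \<open>untwist (- c)\<close>; it preserves heights
  and straightens the surface into the torus times the line.\<close>

definition untwist :: "real \<Rightarrow> ('b::euclidean_space \<times> 'b) \<times> real \<Rightarrow> ('b \<times> 'b) \<times> real" where
  "untwist c p = (rotation (- (c * snd p)) (fst p), snd p)"

section \<open>The surface and its horizontal sections as submanifolds\<close>

lemma mem_torus_iff:
  fixes w :: "'b::euclidean_space \<times> 'b"
  shows "w \<in> sphere 0 (1 / sqrt 2) \<times> sphere 0 (1 / sqrt 2) \<longleftrightarrow>
    norm w = 1 \<and> fst w \<bullet> fst w - snd w \<bullet> snd w = 0"
proof -
  have *: "norm x = 1 / sqrt 2 \<longleftrightarrow> x \<bullet> x = 1 / 2" for x :: 'b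
  proof -
    have "norm x = sqrt (1 / 2) \<longleftrightarrow> x \<bullet> x = 1 / 2"
      unfolding norm_eq_sqrt_inner by (rule real_sqrt_eq_iff)
    then show ?thesis by (simp add: real_sqrt_divide)
  qed
  have "norm w = 1 \<longleftrightarrow> fst w \<bullet> fst w + snd w \<bullet> snd w = 1"
    by (simp add: norm_eq_1 inner_prod_def)
  then show ?thesis by (cases w) (auto simp: *)
qed

text \<open>Rotating back by the angle \<open>c * snd p\<close> preserves the norm, and by
  \<open>mirror_double_angle\<close> it turns the mirror equation into equality of the norms of the
  two components.\<close>

lemma twisted_eq_vimage:
  "(twisted c :: (('b::euclidean_space \<times> 'b) \<times> real) set) =
     untwist c -` ((sphere 0 (1 / sqrt 2) \<times> sphere 0 (1 / sqrt 2)) \<times> UNIV)"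
proof (intro set_eqI)
  fix p :: "('b \<times> 'b) \<times> real"
  show "p \<in> twisted c \<longleftrightarrow> p \<in> untwist c -` ((sphere 0 (1 / sqrt 2) \<times> sphere 0 (1 / sqrt 2)) \<times> UNIV)"
    using mirror_double_angle[of "c * snd p" "fst p"] norm_rotation[of "- (c * snd p)" "fst p"]
    by (simp add: twisted_def untwist_def mem_torus_iff mult.assoc del: mem_Times_iff mem_sphere)
qed

lemma smooth_on_rotation:
  "open U \<Longrightarrow> smooth_on U f \<Longrightarrow> smooth_on U g \<Longrightarrow> smooth_on U (\<lambda>x. rotation (f x) (g x))"
  unfolding rotation_def by (intro smooth_intros)

lemma smooth_on_mirror:
  "open U \<Longrightarrow> smooth_on U f \<Longrightarrow> smooth_on U g \<Longrightarrow> smooth_on U (\<lambda>x. mirror (f x) (g x))"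
  unfolding mirror_def by (intro smooth_intros)

lemma smooth_submanifold_untwist_vimage:
  fixes S :: "(('b::euclidean_space \<times> 'b) \<times> real) set"
  assumes "smooth_submanifold d S"
  shows "smooth_submanifold d (untwist c -` S)"
proof (rule smooth_submanifold_vimage[OF assms])
  show "smooth_on UNIV (untwist c)" "smooth_on UNIV (untwist (- c))"
    unfolding untwist_def[abs_def] by (intro smooth_intros smooth_on_rotation open_UNIV)+
  show "untwist (- c) (untwist c p) = p" "untwist c (untwist (- c) p) = p" for p :: "('b \<times> 'b) \<times> real"
    using rotation_rotation[of "c * snd p" "fst p"] rotation_rotation[of "- (c * snd p)" "fst p"]
    by (simp_all add: untwist_def)
qed

lemma twisted_slice_eq_vimage:
  "(twisted c \<inter> (sphere 0 1 \<times> {t}) :: (('b::euclidean_space \<times> 'b) \<times> real) set) =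
     untwist c -` ((sphere 0 (1 / sqrt 2) \<times> sphere 0 (1 / sqrt 2)) \<times> {t})"
proof -
  have "(twisted c \<inter> (sphere 0 1 \<times> {t}) :: (('b \<times> 'b) \<times> real) set) = twisted c \<inter> UNIV \<times> {t}"
    by (auto simp: twisted_def)
  also have "\<dots> = untwist c -` ((sphere 0 (1 / sqrt 2) \<times> sphere 0 (1 / sqrt 2)) \<times> {t})"
    unfolding twisted_eq_vimage by (rule set_eqI) (simp add: untwist_def mem_Times_iff conj_assoc)
  finally show ?thesis .
qed

lemma smooth_submanifold_torus:
  "smooth_submanifold (2 * DIM('b) - 2)
    (sphere (0 :: 'b::euclidean_space) (1 / sqrt 2) \<times> sphere (0 :: 'b) (1 / sqrt 2))"
proof -
  have "smooth_submanifold (DIM('b) - 1 + (DIM('b) - 1))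
    (sphere (0 :: 'b) (1 / sqrt 2) \<times> sphere (0 :: 'b) (1 / sqrt 2))"
    by (intro smooth_submanifold_Times smooth_submanifold_sphere) auto
  moreover have "DIM('b) - 1 + (DIM('b) - 1) = 2 * DIM('b) - 2" by simp
  ultimately show ?thesis by metis
qed

lemma smooth_submanifold_twisted:
  "smooth_submanifold (2 * DIM('b) - 1) (twisted c :: (('b::euclidean_space \<times> 'b) \<times> real) set)"
proof -
  \<comment> \<open>Subtraction is truncated, so positivity of the dimension enters here.\<close>
  have "2 * DIM('b) - 1 = 2 * DIM('b) - 2 + DIM(real)"
    using DIM_positive[where 'a='b] unfolding DIM_real by linarith
  then show ?thesis
    unfolding twisted_eq_vimage
    by (metis smooth_submanifold_untwist_vimage smooth_submanifold_Times smooth_submanifold_torus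
        smooth_submanifold_UNIV)
qed

lemma smooth_submanifold_twisted_slice:
  "smooth_submanifold (2 * DIM('b) - 2) (twisted c \<inter> (sphere 0 1 \<times> {t}) :: (('b::euclidean_space \<times> 'b) \<times> real) set)"
  unfolding twisted_slice_eq_vimage
  using smooth_submanifold_untwist_vimage smooth_submanifold_Times[OF smooth_submanifold_torus smooth_submanifold_singleton]
  by (metis add.right_neutral)

section \<open>Derivatives of the defining function and of the normal fields\<close>

lemma has_derivative_mirror:
  "((\<lambda>p. mirror (c * snd p + \<beta>) (fst p)) has_derivative
     (\<lambda>h. mirror (c * snd p + \<beta>) (fst h) + (c * snd h) *\<^sub>R mirror (c * snd p + \<beta> + pi / 2) (fst p))) (at p)"
  unfolding mirror_def
  by (rule derivative_eq_intros refl | simp)+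
     (auto simp: fun_eq_iff cos_add sin_add algebra_simps)

text \<open>The factor 2 comes from the symmetry of \<open>mirror\<close>. Phase
  \<open>\<beta> = 0\<close> gives the equation of the surface and \<open>\<beta> = pi / 2\<close>
  gives \<open>swirl\<close>.\<close>

lemma has_derivative_mirror_inner:
  fixes p :: "('a::euclidean_space \<times> 'a) \<times> real"
  shows "((\<lambda>p. mirror (c * snd p + \<beta>) (fst p) \<bullet> fst p) has_derivative
     (\<lambda>h. 2 * (mirror (c * snd p + \<beta>) (fst p) \<bullet> fst h)
        + c * snd h * (mirror (c * snd p + \<beta> + pi / 2) (fst p) \<bullet> fst p))) (at p)"
proof -
  have "((\<lambda>p. fst p) has_derivative fst) (at p)"
    by (auto intro!: derivative_eq_intros)
  from has_derivative_inner[OF has_derivative_mirror this] show ?thesis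
  proof (rule has_derivative_eq_rhs, intro ext)
    fix h :: "('a \<times> 'a) \<times> real"
    show "mirror (c * snd p + \<beta>) (fst p) \<bullet> fst h
        + (mirror (c * snd p + \<beta>) (fst h) + (c * snd h) *\<^sub>R mirror (c * snd p + \<beta> + pi / 2) (fst p)) \<bullet> fst p
      = 2 * (mirror (c * snd p + \<beta>) (fst p) \<bullet> fst h)
        + c * snd h * (mirror (c * snd p + \<beta> + pi / 2) (fst p) \<bullet> fst p)"
      by (simp add: inner_add_left inner_mirror[of _ "fst h"] inner_commute[of "fst h"])
  qed
qed

lemma mirror_add_pi: "mirror (\<alpha> + pi) z = - mirror \<alpha> z"
  by (simp add: mirror_def prod_eq_iff)


text \<open>The height derivative involves two quarter turns, that is minus the defining function,
  which vanishes on the surface. Only the horizontal part of the direction remains.\<close>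

lemma swirl_has_derivative:
  assumes "p \<in> twisted c"
  shows "(swirl c has_derivative (\<lambda>h. 2 * (mirror (2 * c * snd p + pi / 2) (fst p) \<bullet> fst h))) (at p)"
proof -
  have "mirror (2 * c * snd p + pi / 2 + pi / 2) (fst p) \<bullet> fst p = 0"
    using assms mirror_add_pi[of "2 * c * snd p" "fst p"] by (simp add: twisted_def add.assoc)
  then show ?thesis
    using has_derivative_mirror_inner[of "2 * c" "pi / 2" p] by (simp add: swirl_def[abs_def])
qed

lemma conormal_has_derivative:
  assumes "p \<in> twisted c"
  shows "(conormal \<kappa> c has_derivative (\<lambda>h.
     (mirror (2 * c * snd p) (fst h) + (2 * c * snd h) *\<^sub>R mirror (2 * c * snd p + pi / 2) (fst p),
      \<kappa> * c * (2 * (mirror (2 * c * snd p + pi / 2) (fst p) \<bullet> fst h))))) (at p)"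
  unfolding conormal_def[abs_def]
  using has_derivative_mirror[of "2 * c" 0 p]
  by (intro has_derivative_Pair has_derivative_mult_right swirl_has_derivative assms) simp

text \<open>A scaling factor depending on \<open>swirl\<close> alone covers both the Riemannian and
  the Lorentzian normalisation.\<close>

lemma field_has_derivative:
  assumes "p \<in> twisted c" "(\<eta> has_real_derivative \<eta>') (at (swirl c p))"
  shows "((\<lambda>x. \<eta> (swirl c x) *\<^sub>R conormal \<kappa> c x) has_derivative (\<lambda>h.
     \<eta> (swirl c p) *\<^sub>R
      (mirror (2 * c * snd p) (fst h) + (2 * c * snd h) *\<^sub>R mirror (2 * c * snd p + pi / 2) (fst p),
      \<kappa> * c * (2 * (mirror (2 * c * snd p + pi / 2) (fst p) \<bullet> fst h)))
     + (\<eta>' * (2 * (mirror (2 * c * snd p + pi / 2) (fst p) \<bullet> fst h))) *\<^sub>R conormal \<kappa> c p)) (at p)"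
  using has_derivative_compose[OF swirl_has_derivative[OF assms(1)] assms(2)[unfolded has_field_derivative_def]]
  by (intro has_derivative_scaleR conormal_has_derivative assms(1))

section \<open>Normal vectors, tangent spaces and projections\<close>

lemma twistedD:
  assumes "p \<in> twisted c"
  shows "fst p \<bullet> fst p = 1" "mirror (2 * c * snd p) (fst p) \<bullet> fst p = 0"
    "mirror (2 * c * snd p) (fst p) \<bullet> mirror (2 * c * snd p) (fst p) = 1"
    "mirror (2 * c * snd p + pi / 2) (fst p) \<bullet> mirror (2 * c * snd p) (fst p) = 0"
  using assms mirror_shift_orthogonal[of "2 * c * snd p" "fst p"]
  by (auto simp: twisted_def norm_eq_1 inner_mirror mirror_mirror)

lemma conormal_inner_self:
  "p \<in> twisted c \<Longrightarrow> conormal 1 c p \<bullet> conormal 1 c p = 1 + (c * swirl c p)\<^sup>2"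
  by (simp add: conormal_def twistedD power2_eq_square)

lemma twist_normal_inner_self: "p \<in> twisted c \<Longrightarrow> twist_normal c p \<bullet> twist_normal c p = 1"
  using sum_power2_gt_zero_iff[of 1 "c * swirl c p"]
  by (simp add: twist_normal_def conormal_inner_self real_sqrt_mult_self abs_if)

lemma inner_twist_normal_eq_0_iff: "v \<bullet> twist_normal c p = 0 \<longleftrightarrow> v \<bullet> conormal 1 c p = 0"
  using sum_power2_gt_zero_iff[of 1 "c * swirl c p"]
  by (simp add: twist_normal_def)

lemma inner_conormal:
  "v \<bullet> conormal \<kappa> c p = fst v \<bullet> mirror (2 * c * snd p) (fst p) + snd v * (\<kappa> * c * swirl c p)"
  by (cases v) (simp add: conormal_def)

text \<open>The two equations of the surface have orthogonal gradients along
  \<open>(fst p, 0)\<close> and the conormal, and the dimensions match. Allowing any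
  full-dimensional submanifold \<open>S\<close> inside the surface includes its open spacelike
  part.\<close>

lemma tangent_space_twisted:
  fixes S :: "(('b::euclidean_space \<times> 'b) \<times> real) set"
  assumes "smooth_submanifold (2 * DIM('b) - 1) S" "S \<subseteq> twisted c" "p \<in> S"
  shows "tangent_space S p = {v. \<forall>n\<in>{(fst p, 0), twist_normal c p}. v \<bullet> n = 0}"
proof (rule tangent_space_eqI[OF assms(1,3)])
  have p: "p \<in> twisted c" using assms by blast
  note P = twistedD[OF p]
  show "tangent_space S p \<subseteq> {v. \<forall>n\<in>{(fst p, 0), twist_normal c p}. v \<bullet> n = 0}"
  proof
    fix v assume v: "v \<in> tangent_space S p"
    have "((\<lambda>x. fst x \<bullet> fst x) has_derivative (\<lambda>h. 2 * (fst p \<bullet> fst h))) (at p)"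
      by (auto intro!: derivative_eq_intros simp: inner_commute)
    then have pv: "2 * (fst p \<bullet> fst v) = 0"
      by (rule tangent_space_const_on[OF v]) (use assms(2) twistedD(1) in blast)
    \<comment> \<open>The summand \<open>0\<close> is the phase expected by
      \<open>has_derivative_mirror_inner\<close>.\<close>
    have "mirror (2 * c * snd x + 0) (fst x) \<bullet> fst x = 0" if "x \<in> S" for x
      using twistedD(2)[of x c] that assms(2) by force
    from tangent_space_const_on[OF v has_derivative_mirror_inner[of "2 * c" 0 p] this]
    have "2 * (mirror (2 * c * snd p) (fst p) \<bullet> fst v) + 2 * c * snd v * swirl c p = 0"
      by (simp add: swirl_def)
    then have 2: "v \<bullet> conormal 1 c p = 0"
      by (simp add: inner_conormal inner_commute mult_ac)
    have 1: "fst v \<bullet> fst p = 0" using pv by (simp add: inner_commute)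
    show "v \<in> {v. \<forall>n\<in>{(fst p, 0), twist_normal c p}. v \<bullet> n = 0}"
      using 1 2 by (simp add: inner_twist_normal_eq_0_iff inner_Pair_0)
  qed
  have o: "(fst p, 0) \<bullet> twist_normal c p = 0"
    using P(2) by (simp add: inner_twist_normal_eq_0_iff inner_conormal inner_commute[of "fst p"])
  show "subspace {v. \<forall>n\<in>{(fst p, 0), twist_normal c p}. v \<bullet> n = 0}"
    by (auto simp: subspace_def inner_add_left)
  have ne: "(fst p, 0) \<noteq> twist_normal c p"
    using o twist_normal_inner_self[OF p] by auto
  have "dim {v. \<forall>n\<in>{(fst p, 0), twist_normal c p}. v \<bullet> n = 0}
      = DIM(('b \<times> 'b) \<times> real) - card {(fst p, 0), twist_normal c p}"
  proof (intro dim_orthogonal_complement)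
    have "fst p \<noteq> 0" "twist_normal c p \<noteq> 0"
      using P(1) twist_normal_inner_self[OF p] by force+
    then show "0 \<notin> {(fst p, 0), twist_normal c p}" by (auto simp: prod_eq_iff)
  qed (use o in \<open>auto simp: pairwise_def orthogonal_def inner_commute\<close>)
  then show "dim {v. \<forall>n\<in>{(fst p, 0), twist_normal c p}. v \<bullet> n = 0} = 2 * DIM('b) - 1"
    using ne by simp
qed

lemma tangent_space_sphere_cylinder:
  fixes p :: "'a::euclidean_space \<times> real"
  assumes "p \<in> sphere 0 1 \<times> UNIV"
  shows "tangent_space (sphere 0 1 \<times> UNIV) p = {v. \<forall>n\<in>{(fst p, 0)}. v \<bullet> n = 0}"
proof (rule tangent_space_eqI)
  show "smooth_submanifold (DIM('a) - 1 + DIM(real)) (sphere (0 :: 'a) 1 \<times> (UNIV :: real set))"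
    by (intro smooth_submanifold_Times smooth_submanifold_sphere smooth_submanifold_UNIV) auto
  show "tangent_space (sphere 0 1 \<times> UNIV) p \<subseteq> {v. \<forall>n\<in>{(fst p, 0)}. v \<bullet> n = 0}"
  proof
    fix v assume v: "v \<in> tangent_space (sphere 0 1 \<times> UNIV) p"
    have "((\<lambda>x. fst x \<bullet> fst x) has_derivative (\<lambda>h. 2 * (fst p \<bullet> fst h))) (at p)"
      by (auto intro!: derivative_eq_intros simp: inner_commute)
    then have "2 * (fst p \<bullet> fst v) = 0"
      by (rule tangent_space_const_on[OF v]) (auto simp: norm_eq_1)
    then have "fst v \<bullet> fst p = 0"
      by (simp add: inner_commute)
    then show "v \<in> {v. \<forall>n\<in>{(fst p, 0)}. v \<bullet> n = 0}"
      by (simp add: inner_Pair_0)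
  qed
  show "subspace {v. \<forall>n\<in>{(fst p, 0::real)}. v \<bullet> n = 0}"
    by (auto simp: subspace_def inner_add_left)
  have "fst p \<noteq> 0" using assms by auto
  then have "dim {v. \<forall>n\<in>{(fst p, 0::real)}. v \<bullet> n = 0} = DIM('a \<times> real) - card {(fst p, 0::real)}"
    by (intro dim_orthogonal_complement) (auto simp: zero_prod_def)
  then show "dim {v. \<forall>n\<in>{(fst p, 0::real)}. v \<bullet> n = 0} = DIM('a) - 1 + DIM(real)"
    using DIM_positive[where 'a='a] by simp
qed (use assms in auto)

lemma orth_proj_sphere_cylinder:
  fixes p :: "'a::euclidean_space \<times> real"
  assumes "p \<in> sphere 0 1 \<times> UNIV"
  shows "orth_proj (tangent_space (sphere 0 1 \<times> UNIV) p) w = w - (fst w \<bullet> fst p) *\<^sub>R (fst p, 0)"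
  unfolding tangent_space_sphere_cylinder[OF assms]
proof (rule orth_proj_eqI)
  show "subspace {v. \<forall>n\<in>{(fst p, 0::real)}. v \<bullet> n = 0}"
    by (auto simp: subspace_def inner_add_left)
  show "w - (fst w \<bullet> fst p) *\<^sub>R (fst p, 0) \<in> {v. \<forall>n\<in>{(fst p, 0)}. v \<bullet> n = 0}"
    using assms by (auto simp: inner_Pair_0 inner_diff_left norm_eq_1 mem_Times_iff)
qed (simp add: inner_Pair_0 inner_commute)

section \<open>Riemannian and Lorentzian mean curvature\<close>

text \<open>The condition on \<open>\<eta>\<close> says that the derivative of the field has no component along the normal.\<close>

lemma trace_cov_deriv_field:
  fixes S :: "(('b::euclidean_space \<times> 'b) \<times> real) set"
  assumes S: "smooth_submanifold (2 * DIM('b) - 1) S" "S \<subseteq> twisted c" "p \<in> S"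
    and \<eta>: "(\<eta> has_real_derivative \<eta>') (at (swirl c p))"
      "\<eta>' * (1 + \<kappa> * (c * swirl c p)\<^sup>2) + \<eta> (swirl c p) * \<kappa> * c\<^sup>2 * swirl c p = 0"
  shows "trace_on (tangent_space S p)
    (\<lambda>X. - cov_deriv (sphere 0 1 \<times> UNIV) S (\<lambda>x. \<eta> (swirl c x) *\<^sub>R conormal \<kappa> c x) p X) = 0"
proof -
  have p: "p \<in> twisted c" and pM: "p \<in> sphere 0 1 \<times> UNIV"
    using S by (auto simp: twisted_def mem_Times_iff)
  note P = twistedD[OF p]
  define q where "q = fst p"
  define R :: "'b \<times> 'b \<Rightarrow> 'b \<times> 'b" where "R = mirror (2 * c * snd p)"
  define C where "C = mirror (2 * c * snd p + pi / 2) q"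
  define W where "W = conormal 1 c p"
  define g where "g = swirl c p"
  define Y' where "Y' h = \<eta> g *\<^sub>R (R (fst h) + (2 * c * snd h) *\<^sub>R C, \<kappa> * c * (2 * (C \<bullet> fst h)))
     + (\<eta>' * (2 * (C \<bullet> fst h))) *\<^sub>R (R q, \<kappa> * c * g)" for h
  define V where "V = {v. \<forall>n\<in>{(q, 0), twist_normal c p}. v \<bullet> n = 0}"
  let ?T = "\<lambda>X. - cov_deriv (sphere 0 1 \<times> UNIV) S (\<lambda>x. \<eta> (swirl c x) *\<^sub>R conormal \<kappa> c x) p X"
  have TS: "tangent_space S p = V"
    using tangent_space_twisted[OF S] by (simp add: V_def q_def)
  have Y': "((\<lambda>x. \<eta> (swirl c x) *\<^sub>R conormal \<kappa> c x) has_derivative Y') (at p)"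
    using field_has_derivative[OF p \<eta>(1), of \<kappa>]
    by (rule has_derivative_eq_rhs) (simp add: Y'_def fun_eq_iff R_def C_def q_def g_def conormal_def)
  have linY: "linear Y'" by (rule has_derivative_linear[OF Y'])
  have T: "?T X = - (Y' X - (fst (Y' X) \<bullet> q) *\<^sub>R (q, 0))" if "X \<in> V" for X
    using deriv_along_eq[OF _ Y', of X S] that
    unfolding cov_deriv_def orth_proj_sphere_cylinder[OF pM] by (simp add: TS q_def)
  have C: "C \<bullet> R q = 0" "R q \<bullet> q = 0" "R q \<bullet> R q = 1" "q \<bullet> q = 1" "q \<bullet> R q = 0" "C \<bullet> q = g"
    using P by (simp_all add: C_def R_def q_def g_def swirl_def inner_commute)
  have RR: "R x \<bullet> R q = x \<bullet> q" for x
    unfolding R_def inner_mirror mirror_mirror ..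
  have W: "W = (R q, c * g)" by (simp add: W_def conormal_def R_def q_def g_def)
  \<comment> \<open>After \<open>C \<bullet> R q = 0\<close> and the involution property, the
    condition on \<open>\<eta>\<close> appears as a factor. The projection to the cylinder therefore
    already lands in the tangent space of \<open>S\<close>, and only the \<open>q\<close> component
    is removed.\<close>
  have YW: "Y' X \<bullet> W = 0" if "fst X \<bullet> q = 0" for X
  proof -
    have "Y' X \<bullet> W = 2 * (C \<bullet> fst X) * (\<eta>' * (1 + \<kappa> * (c * g)\<^sup>2) + \<eta> g * \<kappa> * c\<^sup>2 * g)"
      using that C RR by (simp add: Y'_def W inner_add_left power2_eq_square algebra_simps)
    then show ?thesis using \<eta>(2) by (simp add: g_def)
  qed
  have "trace_on V ?T = (\<Sum>e\<in>Basis. - Y' e \<bullet> e) - (\<Sum>n\<in>{(q, 0), twist_normal c p}. - Y' n \<bullet> n)"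
  proof (rule trace_on_orthogonal_complement[OF _ _ _ V_def])
    show "pairwise orthogonal {(q, 0), twist_normal c p}"
      using C by (auto simp: pairwise_def orthogonal_def inner_twist_normal_eq_0_iff
          inner_commute[of "twist_normal c p"] W[unfolded W_def])
    show "norm n = 1" if "n \<in> {(q, 0), twist_normal c p}" for n
      using that C twist_normal_inner_self[OF p] by (auto simp: norm_eq_1)
    fix X assume X: "X \<in> V"
    then have "Y' X \<bullet> W = 0" by (intro YW) (simp add: V_def inner_Pair_0)
    then show "?T X \<in> V"
      unfolding T[OF X] using C
      by (simp add: V_def inner_twist_normal_eq_0_iff inner_Pair_0 inner_diff_left W[unfolded W_def] W)
    show "?T X \<bullet> Z = - Y' X \<bullet> Z" if "Z \<in> V" for Z
      unfolding T[OF X] using that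
      by (simp add: V_def inner_diff_right inner_Pair_0 inner_commute[of _ Z])
  next
    show "linear (\<lambda>h. - Y' h)" using linY by (rule linear_compose_neg)
  qed auto
  \<comment> \<open>\<open>R\<close> is traceless, the rank-one term has trace proportional to
    \<open>C \<bullet> R q\<close>, and the vertical diagonal entry is zero.\<close>
  also have "(\<Sum>e\<in>Basis. - Y' e \<bullet> e) = 0"
  proof -
    have "Y' (i, 0) \<bullet> (i, 0) = \<eta> g * (R i \<bullet> i) + 2 * \<eta>' * ((C \<bullet> i) * (R q \<bullet> i))" for i
      by (simp add: Y'_def inner_add_left)
    moreover have "(\<Sum>i\<in>Basis. (C \<bullet> i) * (R q \<bullet> i)) = 0"
      using C(1) by (simp add: euclidean_inner[of C "R q"])
    moreover have "(\<Sum>i\<in>Basis. R i \<bullet> i) = 0"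
      unfolding R_def by (rule trace_mirror)
    moreover have "Y' (0, 1) \<bullet> (0, 1) = 0" by (simp add: Y'_def)
    ultimately show ?thesis
      by (subst sum_Basis_prod) (simp add: sum_negf sum_subtractf mult.assoc flip: sum_distrib_left)
  qed
  \<comment> \<open>Both values reduce to multiples of \<open>R q \<bullet> q\<close> and
    \<open>C \<bullet> R q\<close>; for the normal it is enough to treat its multiple
    \<open>W\<close>.\<close>
  also have "(\<Sum>n\<in>{(q, 0), twist_normal c p}. - Y' n \<bullet> n) = 0"
  proof -
    have "Y' (q, 0) \<bullet> (q, 0) = 0" using C by (simp add: Y'_def inner_add_left)
    moreover have "Y' W \<bullet> W = 0"
      using C RR by (simp add: Y'_def W inner_add_left)
    then have "Y' (twist_normal c p) \<bullet> twist_normal c p = 0"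
      by (simp add: twist_normal_def linear_cmul[OF linY] W_def)
    ultimately show ?thesis by (intro sum.neutral) auto
  qed
  finally show ?thesis by (simp add: TS)
qed

text \<open>Since \<open>\<kappa> * \<kappa> = 1\<close>, the inverse square root solves the
  differential equation for \<open>\<eta>\<close> required by \<open>trace_cov_deriv_field\<close>.
  The constant \<open>\<sigma>\<close> carries the sign of the Lorentzian normal.\<close>

lemma trace_twist_field:
  fixes S :: "(('b::euclidean_space \<times> 'b) \<times> real) set"
  assumes S: "smooth_submanifold (2 * DIM('b) - 1) S" "S \<subseteq> twisted c" "p \<in> S"
    and \<kappa>: "\<kappa> * \<kappa> = 1" "0 < \<kappa> + (c * swirl c p)\<^sup>2"
  shows "trace_on (tangent_space S p) (\<lambda>X. - cov_deriv (sphere 0 1 \<times> UNIV) S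
      (\<lambda>x. (\<sigma> / sqrt (\<kappa> + (c * swirl c x)\<^sup>2)) *\<^sub>R conormal \<kappa> c x) p X) = 0"
proof (rule trace_cov_deriv_field[OF S])
  define g s where "g = swirl c p" and "s = \<kappa> + (c * g)\<^sup>2"
  have s: "0 < s" using \<kappa> by (simp add: s_def g_def)
  show "((\<lambda>x. \<sigma> / sqrt (\<kappa> + (c * x)\<^sup>2)) has_real_derivative - (\<sigma> * c\<^sup>2 * g) / (sqrt s * s)) (at (swirl c p))"
    unfolding g_def[symmetric] using s[unfolded s_def]
    by (auto intro!: derivative_eq_intros simp: s_def field_simps power2_eq_square)
  have "1 + \<kappa> * (c * g)\<^sup>2 = \<kappa> * s" using \<kappa>(1) by (simp add: s_def algebra_simps)
  then show "- (\<sigma> * c\<^sup>2 * g) / (sqrt s * s) * (1 + \<kappa> * (c * swirl c p)\<^sup>2)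
      + \<sigma> / sqrt (\<kappa> + (c * swirl c p)\<^sup>2) * \<kappa> * c\<^sup>2 * swirl c p = 0"
    using s by (simp add: g_def[symmetric] s_def[symmetric])
qed

lemma mean_curvature_twisted:
  fixes S :: "(('b::euclidean_space \<times> 'b) \<times> real) set"
  assumes "smooth_submanifold (2 * DIM('b) - 1) S" "S \<subseteq> twisted c" "p \<in> S"
  shows "mean_curvature (sphere 0 1 \<times> UNIV) S (twist_normal c) p = 0"
  using trace_twist_field[OF assms, of 1 1]
  by (simp add: mean_curvature_def shape_operator_def[abs_def] twist_normal_def[abs_def] add_pos_nonneg)

lemma angle_twist_normal:
  "angle_function (twist_normal c) p = c * swirl c p / sqrt (1 + (c * swirl c p)\<^sup>2)"
  by (simp add: angle_function_def twist_normal_def conormal_def vertical_field_def)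

text \<open>Subtracting twice the vertical part reverses the vertical component, which turns
  \<open>\<kappa> = 1\<close> into \<open>\<kappa> = - 1\<close>, and the Riemannian length
  \<open>r\<close> cancels. The equation holds at every point, with \<open>sqrt\<close> and division
  total, so it can be rewritten as an equation of functions inside the covariant derivative.\<close>

lemma lorentz_normal_twist:
  "lorentz_normal (twist_normal c) p = (- 1 / sqrt (- 1 + (c * swirl c p)\<^sup>2)) *\<^sub>R conormal (- 1) c p"
proof -
  define x where "x = c * swirl c p"
  define r where "r = sqrt (1 + x\<^sup>2)"
  have r: "0 < r" "r\<^sup>2 = 1 + x\<^sup>2" by (simp_all add: r_def add_pos_nonneg)
  have \<Theta>: "angle_function (twist_normal c) p = x / r"
    by (simp add: angle_twist_normal x_def r_def)
  have "2 * (x / r)\<^sup>2 - 1 = (2 * x\<^sup>2 - r\<^sup>2) / r\<^sup>2"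
    using r(1) by (simp add: power_divide diff_divide_distrib)
  also have "\<dots> = (- 1 + x\<^sup>2) / r\<^sup>2"
    unfolding r(2) by simp
  finally have "sqrt (2 * (x / r)\<^sup>2 - 1) = sqrt (- 1 + x\<^sup>2) / r"
    using r(1) by (simp add: real_sqrt_divide)
  moreover have "twist_normal c p - (2 * (x / r)) *\<^sub>R \<partial>t = (1 / r) *\<^sub>R conormal (- 1) c p"
    by (simp add: twist_normal_def conormal_def vertical_field_def x_def[symmetric] r_def[symmetric]
        mult.assoc[symmetric])
  ultimately show ?thesis
    unfolding lorentz_normal_def \<Theta> x_def[symmetric] using r(1) by simp
qed

lemma lorentz_mean_curvature_twisted:
  fixes S :: "(('b::euclidean_space \<times> 'b) \<times> real) set"
  assumes "smooth_submanifold (2 * DIM('b) - 1) S" "S \<subseteq> twisted c" "p \<in> S"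
    and "1 < (c * swirl c p)\<^sup>2"
  shows "lorentz_mean_curvature (sphere 0 1) S (twist_normal c) p = 0"
  using trace_twist_field[OF assms(1-3), of "- 1" "- 1"] assms(4)
  by (simp add: lorentz_mean_curvature_def lorentz_shape_operator_def[abs_def] lorentz_normal_twist[abs_def])

section \<open>Hypersurface structure, unit normal, causal character and height gradient\<close>

lemma hypersurface_twisted:
  fixes S :: "(('b::euclidean_space \<times> 'b) \<times> real) set"
  assumes "smooth_submanifold (2 * DIM('b) - 1) S" "S \<subseteq> twisted c"
  shows "hypersurface (sphere 0 1 \<times> UNIV) S"
  unfolding hypersurface_def
proof (intro conjI exI)
  show "S \<subseteq> sphere 0 1 \<times> UNIV" using assms(2) by (auto simp: twisted_def mem_Times_iff)
  have "smooth_submanifold (DIM('b \<times> 'b) - 1 + DIM(real)) (sphere (0 :: 'b \<times> 'b) 1 \<times> (UNIV :: real set))"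
    by (intro smooth_submanifold_Times smooth_submanifold_sphere smooth_submanifold_UNIV) auto
  moreover have "DIM('b \<times> 'b) - 1 + DIM(real) = Suc (2 * DIM('b) - 1)"
    using DIM_positive[where 'a='b] unfolding DIM_real DIM_prod by linarith
  ultimately show "smooth_submanifold (Suc (2 * DIM('b) - 1)) (sphere (0 :: 'b \<times> 'b) 1 \<times> (UNIV :: real set))"
    by metis
qed (rule assms(1))

lemma smooth_on_conormal: "smooth_on UNIV (conormal \<kappa> c)"
  unfolding conormal_def[abs_def] swirl_def
  by (intro smooth_intros smooth_on_mirror open_UNIV)

lemma smooth_on_swirl: "smooth_on UNIV (swirl c)"
  unfolding swirl_def[abs_def]
  by (intro smooth_intros smooth_on_mirror open_UNIV)

lemma smooth_on_twist_normal: "smooth_on UNIV (twist_normal c)"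
proof -
  have "smooth_on UNIV (\<lambda>p. ((1 + (c * swirl c p) * (c * swirl c p)) powr (- 1 / 2)) *\<^sub>R conormal 1 c p)"
    by (intro smooth_on_scaleR smooth_on_powr smooth_on_add smooth_on_mult smooth_on_const
        smooth_on_swirl smooth_on_conormal open_UNIV) (simp add: add_pos_nonneg)
  moreover have "(1 + y * y) powr (- 1 / 2) = 1 / sqrt (1 + y\<^sup>2)" for y :: real
  proof -
    have "(1 + y * y) powr (- (1 / 2)) = inverse ((1 + y * y) powr (1 / 2))" by (rule powr_minus)
    then show ?thesis by (simp add: powr_half_sqrt power2_eq_square field_simps)
  qed
  ultimately show ?thesis by (simp add: twist_normal_def[abs_def])
qed

lemma unit_normal_field_twisted:
  fixes S :: "(('b::euclidean_space \<times> 'b) \<times> real) set"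
  assumes "smooth_submanifold (2 * DIM('b) - 1) S" "S \<subseteq> twisted c"
  shows "unit_normal_field (sphere 0 1 \<times> UNIV) S (twist_normal c)"
  unfolding unit_normal_field_def
proof (intro conjI ballI)
  show "smooth_along S (twist_normal c)"
    unfolding smooth_along_def using smooth_on_twist_normal open_UNIV by blast
  fix p assume "p \<in> S"
  then have p: "p \<in> twisted c" and pM: "p \<in> sphere 0 1 \<times> UNIV"
    using assms(2) by (auto simp: twisted_def mem_Times_iff)
  show "norm (twist_normal c p) = 1" using twist_normal_inner_self[OF p] by (simp add: norm_eq_1)
  have "(fst p, 0) \<bullet> twist_normal c p = 0"
    using twistedD(2)[OF p] by (simp add: inner_twist_normal_eq_0_iff inner_conormal inner_commute[of "fst p"])
  then show "twist_normal c p \<in> tangent_space (sphere 0 1 \<times> UNIV) p"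
    by (simp add: tangent_space_sphere_cylinder[OF pM] inner_commute)
  show "twist_normal c p \<bullet> v = 0" if "v \<in> tangent_space S p" for v
    using that by (simp add: tangent_space_twisted[OF assms \<open>p \<in> S\<close>] inner_commute)
qed

text \<open>Orthogonality to the conormal expresses \<open>snd X * ?x\<close> through the inner
  product of \<open>fst X\<close> with the unit vector \<open>?R\<close>. Cauchy-Schwarz and
  \<open>1 < ?x\<^sup>2\<close> then make the horizontal part dominate.\<close>

lemma spacelike_twisted:
  fixes S :: "(('b::euclidean_space \<times> 'b) \<times> real) set"
  assumes "smooth_submanifold (2 * DIM('b) - 1) S" "S \<subseteq> twisted c"
    and "\<And>p. p \<in> S \<Longrightarrow> 1 < (c * swirl c p)\<^sup>2"
  shows "spacelike S"
  unfolding spacelike_def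
proof (intro ballI impI)
  fix p X assume p: "p \<in> S" and X: "X \<in> tangent_space S p" "X \<noteq> 0"
  have pt: "p \<in> twisted c" using p assms by auto
  let ?R = "mirror (2 * c * snd p) (fst p)" and ?x = "c * swirl c p"
  have "X \<bullet> conormal 1 c p = 0"
    using X by (simp add: tangent_space_twisted[OF assms(1,2) p] inner_twist_normal_eq_0_iff)
  then have "snd X * ?x = - (fst X \<bullet> ?R)" by (simp add: inner_conormal)
  then have "(snd X)\<^sup>2 * ?x\<^sup>2 = (fst X \<bullet> ?R)\<^sup>2" by (metis power2_minus power_mult_distrib)
  also have "\<dots> \<le> (fst X \<bullet> fst X) * (?R \<bullet> ?R)" by (rule Cauchy_Schwarz_ineq)
  finally have le: "(snd X)\<^sup>2 * ?x\<^sup>2 \<le> fst X \<bullet> fst X" using twistedD(3)[OF pt] by simp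
  show "0 < lorentz_product X X"
  proof (cases "snd X = 0")
    case True
    then have "fst X \<noteq> 0" using X(2) by (auto simp: prod_eq_iff)
    then show ?thesis using True by (simp add: lorentz_product_def)
  next
    case False
    then have "(snd X)\<^sup>2 * 1 < (snd X)\<^sup>2 * ?x\<^sup>2"
      by (intro mult_strict_left_mono assms(3)[OF p]) simp
    then show ?thesis using le by (simp add: lorentz_product_def power2_eq_square)
  qed
qed

text \<open>The height gradient is the tangential part of the vertical unit vector, and its
  horizontal part is a multiple of \<open>R\<close>. This is orthogonal to \<open>C\<close> and
  isotropic for the quadratic form of \<open>mirror\<close>, which removes every term.\<close>

lemma shape_operator_gradient_twisted:
  fixes p :: "('b::euclidean_space \<times> 'b) \<times> real"
  assumes "p \<in> twisted c"
  shows "shape_operator (sphere 0 1 \<times> UNIV) (twisted c) (twist_normal c) p (gradient (twisted c) snd p)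
     \<bullet> gradient (twisted c) snd p = 0"
proof -
  have pM: "p \<in> sphere 0 1 \<times> UNIV"
    using assms by (auto simp: twisted_def mem_Times_iff)
  note T = tangent_space_twisted[OF smooth_submanifold_twisted order_refl assms]
  note P = twistedD[OF assms]
  define N where "N = twist_normal c p"
  define R where "R = mirror (2 * c * snd p) (fst p)"
  define C where "C = mirror (2 * c * snd p + pi / 2) (fst p)"
  define v where "v = (0, 1) - snd N *\<^sub>R N"
  have NN: "N \<bullet> N = 1" unfolding N_def by (rule twist_normal_inner_self[OF assms])
  have Nq: "N \<bullet> (fst p, 0) = 0"
    using P(2) by (simp add: N_def twist_normal_def conormal_def)
  have vT: "v \<in> tangent_space (twisted c) p"
    using NN Nq by (simp add: T v_def inner_diff_left N_def[symmetric] inner_Pair_0)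
       (simp add: inner_commute inner_Pair_0)
  have sub: "subspace (tangent_space (twisted c) p)"
    unfolding T by (auto simp: subspace_def inner_add_left)
  have grad: "gradient (twisted c) snd p = v"
  proof (rule gradient_eqI[OF sub vT])
    show "(snd has_derivative snd) (at p)" by (auto intro!: derivative_eq_intros)
    show "v \<bullet> X = snd X" if "X \<in> tangent_space (twisted c) p" for X
      using that by (cases X) (simp add: T v_def inner_diff_left inner_commute[of N] flip: N_def)
  qed
  define g where "g = swirl c p"
  define h where "h = 1 / sqrt (1 + (c * g)\<^sup>2)"
  have 1: "((\<lambda>x. 1 / sqrt (1 + (c * x)\<^sup>2)) has_real_derivative - (c\<^sup>2 * g) / (sqrt (1 + (c * g)\<^sup>2) * (1 + (c * g)\<^sup>2))) (at (swirl c p))"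
    unfolding g_def[symmetric] using sum_power2_gt_zero_iff[of 1 "c * g"]
    by (auto intro!: derivative_eq_intros simp: field_simps power2_eq_square)
  \<comment> \<open>The derivative of the normalising factor stays an unspecified
    \<open>\<eta>'\<close>: it occurs only multiplied by \<open>C \<bullet> fst w\<close>, which is
    zero for \<open>w = v\<close>.\<close>
  from field_has_derivative[OF assms this, of 1] obtain \<eta>' where
    Y: "(twist_normal c has_derivative (\<lambda>w. h *\<^sub>R
      (mirror (2 * c * snd p) (fst w) + (2 * c * snd w) *\<^sub>R C, 1 * c * (2 * (C \<bullet> fst w)))
     + (\<eta>' * (2 * (C \<bullet> fst w))) *\<^sub>R conormal 1 c p)) (at p)"
    unfolding twist_normal_def[abs_def] h_def g_def C_def by blast
  have fv: "fst v = (- snd N * h) *\<^sub>R R"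
    by (simp add: v_def N_def twist_normal_def conormal_def R_def h_def g_def)
  have CR: "C \<bullet> R = 0" "R \<bullet> C = 0" using P(4) by (simp_all add: C_def R_def inner_commute)
  have RR: "mirror (2 * c * snd p) (fst v) \<bullet> R = fst v \<bullet> fst p"
    by (simp add: R_def inner_mirror mirror_mirror)
  have Rq: "R \<bullet> fst p = 0" using P(2) by (simp add: R_def)
  have d: "deriv_along (twisted c) (twist_normal c) p v =
      h *\<^sub>R (mirror (2 * c * snd p) (fst v) + (2 * c * snd v) *\<^sub>R C, 0)"
    using deriv_along_eq[OF vT Y] CR by (simp add: fv)
  have "mirror (2 * c * snd p) (fst v) \<bullet> fst v = 0"
    using RR Rq by (simp add: fv)
  moreover have "C \<bullet> fst v = 0" using CR by (simp add: fv)
  ultimately have "deriv_along (twisted c) (twist_normal c) p v \<bullet> v = 0"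
    unfolding d by (cases v) (simp add: inner_add_left)
  \<comment> \<open>Hence the projection to the cylinder does not change the inner product with
    \<open>v\<close>.\<close>
  moreover have "(fst p, 0) \<bullet> v = 0"
    using vT by (simp add: T inner_commute)
  ultimately show ?thesis
    unfolding grad shape_operator_def cov_deriv_def orth_proj_sphere_cylinder[OF pM]
    by (simp add: inner_diff_left del: scaleR_Pair)
qed

section \<open>Horizontal sections\<close>

lemma tangent_space_sphere_slice:
  fixes p :: "'a::euclidean_space \<times> real"
  assumes "p \<in> sphere 0 1 \<times> {t}"
  shows "tangent_space (sphere 0 1 \<times> {t}) p = {v. \<forall>n\<in>{(fst p, 0), (0, 1)}. v \<bullet> n = 0}"
proof (rule tangent_space_eqI)
  show "smooth_submanifold (DIM('a) - 1 + 0) (sphere (0 :: 'a) 1 \<times> {t})"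
    by (intro smooth_submanifold_Times smooth_submanifold_sphere smooth_submanifold_singleton) auto
  show "tangent_space (sphere 0 1 \<times> {t}) p \<subseteq> {v. \<forall>n\<in>{(fst p, 0), (0, 1)}. v \<bullet> n = 0}"
  proof
    fix v assume v: "v \<in> tangent_space (sphere 0 1 \<times> {t}) p"
    have "((\<lambda>x. fst x \<bullet> fst x) has_derivative (\<lambda>h. 2 * (fst p \<bullet> fst h))) (at p)"
      by (auto intro!: derivative_eq_intros simp: inner_commute)
    then have "2 * (fst p \<bullet> fst v) = 0"
      by (rule tangent_space_const_on[OF v]) (auto simp: norm_eq_1)
    then have "fst v \<bullet> fst p = 0" by (simp add: inner_commute)
    moreover have "((\<lambda>x. snd x) has_derivative (\<lambda>h. snd h)) (at p)"
      by (auto intro!: derivative_eq_intros)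
    then have "snd v = 0" by (rule tangent_space_const_on[OF v]) auto
    ultimately show "v \<in> {v. \<forall>n\<in>{(fst p, 0), (0, 1)}. v \<bullet> n = 0}"
      by (simp add: inner_Pair_0)
  qed
  show "subspace {v. \<forall>n\<in>{(fst p, 0::real), (0, 1)}. v \<bullet> n = 0}"
    by (auto simp: subspace_def inner_add_left)
  have "fst p \<noteq> 0" using assms by auto
  then have "dim {v. \<forall>n\<in>{(fst p, 0::real), (0, 1)}. v \<bullet> n = 0} = DIM('a \<times> real) - card {(fst p, 0::real), (0, 1)}"
    by (intro dim_orthogonal_complement) (auto simp: zero_prod_def pairwise_def orthogonal_def)
  then show "dim {v. \<forall>n\<in>{(fst p, 0::real), (0, 1)}. v \<bullet> n = 0} = DIM('a) - 1 + 0"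
    by simp
qed (use assms in auto)

lemma orth_proj_sphere_slice:
  fixes p :: "'a::euclidean_space \<times> real"
  assumes "p \<in> sphere 0 1 \<times> {t}"
  shows "orth_proj (tangent_space (sphere 0 1 \<times> {t}) p) w =
    w - ((fst w \<bullet> fst p) *\<^sub>R (fst p, 0) + snd w *\<^sub>R (0, 1))"
  unfolding tangent_space_sphere_slice[OF assms]
proof (rule orth_proj_eqI)
  show "subspace {v. \<forall>n\<in>{(fst p, 0::real), (0, 1)}. v \<bullet> n = 0}"
    by (auto simp: subspace_def inner_add_left)
  show "w - ((fst w \<bullet> fst p) *\<^sub>R (fst p, 0) + snd w *\<^sub>R (0, 1)) \<in> {v. \<forall>n\<in>{(fst p, 0), (0, 1)}. v \<bullet> n = 0}"
    using assms by (auto simp: inner_Pair_0 inner_diff_left norm_eq_1 mem_Times_iff)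
  show "(w - (w - ((fst w \<bullet> fst p) *\<^sub>R (fst p, 0) + snd w *\<^sub>R (0, 1)))) \<bullet> v = 0"
    if "v \<in> {v. \<forall>n\<in>{(fst p, 0), (0, 1)}. v \<bullet> n = 0}" for v
    using that by (cases v) (simp add: inner_commute)
qed

lemma tangent_space_twisted_slice:
  fixes p :: "('b::euclidean_space \<times> 'b) \<times> real"
  assumes "p \<in> twisted c \<inter> (sphere 0 1 \<times> {t})"
  shows "tangent_space (twisted c \<inter> (sphere 0 1 \<times> {t})) p =
    {v. \<forall>n\<in>{(fst p, 0), (mirror (2 * c * t) (fst p), 0), (0, 1)}. v \<bullet> n = 0}"
proof (rule tangent_space_eqI[OF smooth_submanifold_twisted_slice assms])
  have p: "p \<in> twisted c" and t: "snd p = t" using assms by (auto simp: mem_Times_iff)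
  note P = twistedD[OF p, unfolded t]
  let ?N = "{(fst p, 0), (mirror (2 * c * t) (fst p), 0), (0, 1::real)}"
  show "tangent_space (twisted c \<inter> (sphere 0 1 \<times> {t})) p \<subseteq> {v. \<forall>n\<in>?N. v \<bullet> n = 0}"
  proof
    fix v assume v: "v \<in> tangent_space (twisted c \<inter> (sphere 0 1 \<times> {t})) p"
    have "((\<lambda>x. fst x \<bullet> fst x) has_derivative (\<lambda>h. 2 * (fst p \<bullet> fst h))) (at p)"
      by (auto intro!: derivative_eq_intros simp: inner_commute)
    then have "2 * (fst p \<bullet> fst v) = 0"
      by (rule tangent_space_const_on[OF v]) (use twistedD(1) in blast)
    then have 1: "fst v \<bullet> fst p = 0" by (simp add: inner_commute)
    have "((\<lambda>x. snd x) has_derivative (\<lambda>h. snd h)) (at p)"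
      by (auto intro!: derivative_eq_intros)
    then have 2: "snd v = 0" by (rule tangent_space_const_on[OF v]) auto
    have "mirror (2 * c * snd x + 0) (fst x) \<bullet> fst x = 0" if "x \<in> twisted c \<inter> (sphere 0 1 \<times> {t})" for x
      using twistedD(2)[of x c] that by force
    from tangent_space_const_on[OF v has_derivative_mirror_inner[of "2 * c" 0 p] this] 2
    have "fst v \<bullet> mirror (2 * c * t) (fst p) = 0" by (simp add: t inner_commute)
    then show "v \<in> {v. \<forall>n\<in>?N. v \<bullet> n = 0}"
      using 1 2 by (simp add: inner_Pair_0)
  qed
  show "subspace {v. \<forall>n\<in>?N. v \<bullet> n = 0}"
    by (auto simp: subspace_def inner_add_left)
  have nz: "fst p \<noteq> 0" "mirror (2 * c * t) (fst p) \<noteq> 0" using P(1,3) by force+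
  have ne: "fst p \<noteq> mirror (2 * c * t) (fst p)" using P(1,2) by force
  have "dim {v. \<forall>n\<in>?N. v \<bullet> n = 0} = DIM(('b \<times> 'b) \<times> real) - card ?N"
  proof (intro dim_orthogonal_complement)
    show "0 \<notin> ?N" using nz by (auto simp: prod_eq_iff)
    show "pairwise orthogonal ?N"
      using P(2) by (auto simp: pairwise_def orthogonal_def inner_commute)
  qed auto
  then show "dim {v. \<forall>n\<in>?N. v \<bullet> n = 0} = 2 * DIM('b) - 2"
    using ne nz by simp
qed

text \<open>At fixed height the defining function is a quadratic form, so its normal field
  \<open>N\<close> is linear and equals its own derivative. The trace of \<open>N\<close> is zero,
  and so are its values on the three normals \<open>(fst p, 0)\<close>, \<open>N p\<close> and
  \<open>(0, 1)\<close>.\<close>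

lemma minimal_twisted_slice:
  "minimal_hypersurface (sphere (0 :: 'b::euclidean_space \<times> 'b) 1 \<times> {t}) (twisted c \<inter> (sphere 0 1 \<times> {t}))"
proof -
  let ?P = "sphere (0 :: 'b \<times> 'b) 1 \<times> {t}" and ?S = "twisted c \<inter> (sphere (0 :: 'b \<times> 'b) 1 \<times> {t})"
  define N where "N x = (mirror (2 * c * t) (fst x), 0::real)" for x :: "('b \<times> 'b) \<times> real"
  have N: "(N has_derivative N) (at p)" for p
    unfolding N_def[abs_def]
    by (intro bounded_linear_imp_has_derivative bounded_linear_Pair bounded_linear_zero
        bounded_linear_compose[OF bounded_linear_mirror] bounded_linear_fst)
  have "hypersurface ?P ?S"
    unfolding hypersurface_def
  proof (intro conjI exI)
    have "smooth_submanifold (DIM('b \<times> 'b) - 1 + 0) ?P"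
      by (intro smooth_submanifold_Times smooth_submanifold_sphere smooth_submanifold_singleton) auto
    moreover have "DIM('b \<times> 'b) - 1 + 0 = Suc (2 * DIM('b) - 2)"
      using DIM_positive[where 'a='b] unfolding DIM_prod by linarith
    ultimately show "smooth_submanifold (Suc (2 * DIM('b) - 2)) ?P" by metis
  qed (auto intro: smooth_submanifold_twisted_slice)
  moreover have "unit_normal_field ?P ?S N"
    unfolding unit_normal_field_def
  proof (intro conjI ballI)
    have "smooth_on UNIV N"
      unfolding N_def[abs_def] by (intro smooth_intros smooth_on_mirror open_UNIV)
    then show "smooth_along ?S N"
      unfolding smooth_along_def using open_UNIV by blast
    fix p assume pS: "p \<in> ?S"
    then have p: "p \<in> twisted c" and t: "snd p = t" by (auto simp: mem_Times_iff)
    note P = twistedD[OF p, unfolded t]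
    show "norm (N p) = 1" using P(3) by (simp add: N_def norm_eq_1)
    show "N p \<in> tangent_space ?P p"
      using pS P(2) by (subst tangent_space_sphere_slice) (auto simp: N_def)
    show "N p \<bullet> v = 0" if "v \<in> tangent_space ?S p" for v
      using that unfolding tangent_space_twisted_slice[OF pS] by (simp add: N_def inner_commute)
  qed
  moreover have "mean_curvature ?P ?S N p = 0" if pS: "p \<in> ?S" for p
  proof -
    have p: "p \<in> twisted c" and t: "snd p = t" and pP: "p \<in> ?P" using pS by (auto simp: mem_Times_iff)
    note P = twistedD[OF p, unfolded t]
    let ?N = "{(fst p, 0), N p, (0, 1::real)}"
    define V where "V = {v. \<forall>n\<in>?N. v \<bullet> n = 0}"
    have TS: "tangent_space ?S p = V"
      unfolding tangent_space_twisted_slice[OF pS] V_def N_def ..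
    \<comment> \<open>\<open>N X\<close> has no vertical component, so the projection subtracts only
      the radial one.\<close>
    have T: "shape_operator ?P ?S N p X = - (N X - (fst (N X) \<bullet> fst p) *\<^sub>R (fst p, 0))" if "X \<in> V" for X
      using deriv_along_eq[OF _ N, of X ?S p] that
      unfolding shape_operator_def cov_deriv_def orth_proj_sphere_slice[OF pP]
      by (simp add: TS) (simp add: N_def)
    have NX: "N X \<bullet> N p = fst X \<bullet> fst p" for X
      by (simp add: N_def inner_mirror mirror_mirror)
    have Nq: "N p \<bullet> (fst p, 0) = 0" "(fst p, 0) \<bullet> N p = 0"
      using P(2) by (simp_all add: N_def inner_commute)
    have NN: "N p \<bullet> N p = 1" using P(1) by (simp add: NX)
    have "trace_on V (shape_operator ?P ?S N p) = (\<Sum>e\<in>Basis. - N e \<bullet> e) - (\<Sum>n\<in>?N. - N n \<bullet> n)"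
    proof (rule trace_on_orthogonal_complement[OF _ _ _ V_def])
      show "pairwise orthogonal ?N"
        using Nq by (auto simp: pairwise_def orthogonal_def N_def)
      show "norm n = 1" if "n \<in> ?N" for n
        using that P(1) NN by (auto simp: norm_eq_1)
      fix X assume X: "X \<in> V"
      then have "fst X \<bullet> fst p = 0" by (simp add: V_def inner_Pair_0)
      then show "shape_operator ?P ?S N p X \<in> V"
        unfolding T[OF X] using Nq P(1) NX[of X]
        by (simp add: V_def inner_diff_left inner_Pair_0 del: scaleR_Pair) (simp add: N_def)
      show "shape_operator ?P ?S N p X \<bullet> Z = - N X \<bullet> Z" if "Z \<in> V" for Z
        unfolding T[OF X] using that
        by (simp add: V_def inner_diff_right inner_Pair_0 inner_commute[of _ Z])
    next
      show "linear (\<lambda>h. - N h)" by (rule linear_compose_neg[OF has_derivative_linear[OF N]])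
    qed auto
    also have "(\<Sum>e\<in>Basis. - N e \<bullet> e) = 0"
      by (subst sum_Basis_prod) (simp add: N_def sum_negf trace_mirror)
    also have "(\<Sum>n\<in>?N. - N n \<bullet> n) = 0"
    proof (intro sum.neutral ballI)
      fix n assume "n \<in> ?N"
      then consider "n = (fst p, 0)" | "n = N p" | "n = (0, 1)" by blast
      then show "- N n \<bullet> n = 0"
      proof cases
        case 1
        then show ?thesis using P(2) by (simp add: N_def)
      next
        case 2
        have "N (N p) \<bullet> N p = 0" using P(2) by (simp add: NX) (simp add: N_def)
        then show ?thesis using 2 by simp
      next
        case 3
        then show ?thesis by (simp add: N_def)
      qed
    qed
    finally show ?thesis by (simp add: mean_curvature_def TS)
  qed
  ultimately show ?thesis unfolding minimal_hypersurface_def by blast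
qed

section \<open>Properness, the helicoid and its spacelike part\<close>

lemma closed_twisted: "closed (twisted c)"
proof -
  have c: "continuous_on UNIV (\<lambda>p. mirror (2 * c * snd p) (fst p) \<bullet> fst p)"
    by (intro smooth_on_imp_continuous_on smooth_intros smooth_on_mirror open_UNIV)
  show ?thesis
    unfolding twisted_def
    by (intro closed_Collect_conj closed_Collect_eq c continuous_on_const continuous_on_norm
        continuous_on_fst continuous_on_id)
qed

text \<open>At height 0 the value of \<open>swirl\<close> is twice the inner product of the two
  components, so parallel and antiparallel components give 1 and -1. These points show that the
  angle varies and that a spacelike region exists.\<close>

lemma twisted_swirl_ex:
  assumes "\<epsilon> \<in> {1, - 1}"
  shows "\<exists>p\<in>twisted c :: (('b::euclidean_space \<times> 'b) \<times> real) set. swirl c p = \<epsilon>"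
proof -
  obtain e :: 'b where "e \<in> Basis" using nonempty_Basis by blast
  then have e: "e \<bullet> e = 1" by simp
  let ?p = "(((1 / sqrt 2) *\<^sub>R e, (\<epsilon> / sqrt 2) *\<^sub>R e), 0 :: real)"
  have "?p \<in> twisted c" "swirl c ?p = \<epsilon>"
    using e assms by (auto simp: twisted_def swirl_def mirror_def norm_eq_1)
  then show ?thesis by blast
qed

lemma vertical_helicoid_twisted:
  assumes "c > 0"
  shows "vertical_helicoid (sphere (0 :: 'b::euclidean_space \<times> 'b) 1) (twisted c) (twist_normal c)"
  unfolding vertical_helicoid_def
proof (intro conjI ballI allI impI)
  show "hypersurface (sphere (0 :: 'b \<times> 'b) 1 \<times> UNIV) (twisted c)"
    by (rule hypersurface_twisted[OF smooth_submanifold_twisted order_refl])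
  show "unit_normal_field (sphere (0 :: 'b \<times> 'b) 1 \<times> UNIV) (twisted c) (twist_normal c)"
    by (rule unit_normal_field_twisted[OF smooth_submanifold_twisted order_refl])
  \<comment> \<open>With \<open>x = c * swirl c p\<close> the squared angle is
    \<open>x\<^sup>2 / (1 + x\<^sup>2)\<close>, which is below 1.\<close>
  show "\<not> horizontal_point (twist_normal c) p" for p :: "('b \<times> 'b) \<times> real"
    using sum_power2_gt_zero_iff[of 1 "c * swirl c p"]
    by (simp add: horizontal_point_def angle_twist_normal power_divide)
  show "\<not> angle_function (twist_normal c) constant_on (twisted c :: (('b \<times> 'b) \<times> real) set)"
  proof
    assume "angle_function (twist_normal c) constant_on (twisted c :: (('b \<times> 'b) \<times> real) set)"
    then obtain y where y: "\<And>p :: ('b \<times> 'b) \<times> real. p \<in> twisted c \<Longrightarrow> angle_function (twist_normal c) p = y"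
      by (auto simp: constant_on_def)
    obtain p :: "('b \<times> 'b) \<times> real" where p: "p \<in> twisted c" "swirl c p = 1"
      using twisted_swirl_ex[of 1] by blast
    obtain p' :: "('b \<times> 'b) \<times> real" where p': "p' \<in> twisted c" "swirl c p' = - 1"
      using twisted_swirl_ex[of "- 1"] by blast
    \<comment> \<open>The angles at the two points are opposite and nonzero because
      \<open>c > 0\<close>.\<close>
    have "0 < sqrt (1 + c\<^sup>2)" by (simp add: add_pos_nonneg)
    then show False
      using y[OF p(1)] y[OF p'(1)] assms by (simp add: angle_twist_normal p(2) p'(2) field_simps)
  qed
  show "minimal_hypersurface (sphere (0 :: 'b \<times> 'b) 1 \<times> {t}) (twisted c \<inter> sphere 0 1 \<times> {t})" for t
    by (rule minimal_twisted_slice)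
qed (rule shape_operator_gradient_twisted)

lemma properly_embedded_twisted:
  "properly_embedded_hypersurface (sphere (0 :: 'b::euclidean_space \<times> 'b) 1 \<times> UNIV) (twisted c)"
  unfolding properly_embedded_hypersurface_def
  using hypersurface_twisted[OF smooth_submanifold_twisted order_refl] closed_twisted compact_Int_closed
  by blast

lemma zero_mean_isocurved_twisted:
  "zero_mean_isocurved (sphere (0 :: 'b::euclidean_space \<times> 'b) 1)
     (twisted c \<inter> {p. 1 < (c * swirl c p)\<^sup>2}) (twist_normal c)"
proof -
  have o: "open {p :: ('b \<times> 'b) \<times> real. 1 < (c * swirl c p)\<^sup>2}"
    using smooth_on_imp_continuous_on[OF smooth_on_swirl]
    by (intro open_Collect_less continuous_intros)
  note sm = smooth_submanifold_Int_open[OF smooth_submanifold_twisted o, of c]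
  show ?thesis
    unfolding zero_mean_isocurved_def
    by (intro conjI ballI hypersurface_twisted[OF sm] unit_normal_field_twisted[OF sm] spacelike_twisted[OF sm]
        mean_curvature_twisted[OF sm] lorentz_mean_curvature_twisted[OF sm]) auto
qed

lemma openin_twisted_spacelike:
  "openin (top_of_set (twisted c)) (twisted c \<inter> {p. 1 < (c * swirl c p)\<^sup>2})"
proof (rule openin_open_Int)
  show "open {p :: ('b::euclidean_space \<times> 'b) \<times> real. 1 < (c * swirl c p)\<^sup>2}"
    using smooth_on_imp_continuous_on[OF smooth_on_swirl]
    by (intro open_Collect_less continuous_intros)
qed

section \<open>The exponential parametrisation and the conclusion\<close>

lemma exp_op_J: "exp_op (\<lambda>z. \<theta> *\<^sub>R J_op z) p = rotation \<theta> p"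
proof -
  have J: "J_op z = (- snd z, fst z)" for z :: "(real^'n) \<times> (real^'n)"
    using matrix_vector_mult_diff_rdistrib[of 0 "mat 1" "snd z"]
    by (simp add: J_op_def block_op_def)
  \<comment> \<open>Since \<open>J_op\<close> squares to minus the identity, even powers fall on
    \<open>p\<close> and odd ones on \<open>J_op p\<close>. The library coefficients carry sign and
    factorial, so summation gives the cosine and sine series.\<close>
  have pow: "((\<lambda>z. \<theta> *\<^sub>R J_op z) ^^ m) p /\<^sub>R fact m =
      (cos_coeff m * \<theta> ^ m) *\<^sub>R p + (sin_coeff m * \<theta> ^ m) *\<^sub>R J_op p" for m
  proof (induction m)
    case 0
    show ?case by simp
  next
    case (Suc m)
    let ?T = "\<lambda>z :: (real^'n) \<times> (real^'n). \<theta> *\<^sub>R J_op z"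
    have "(?T ^^ Suc m) p /\<^sub>R fact (Suc m) = (1 / real (Suc m)) *\<^sub>R ?T ((?T ^^ m) p /\<^sub>R fact m)"
      by (simp add: J prod_eq_iff field_simps)
    also have "\<dots> = (cos_coeff (Suc m) * \<theta> ^ Suc m) *\<^sub>R p + (sin_coeff (Suc m) * \<theta> ^ Suc m) *\<^sub>R J_op p"
      unfolding Suc by (simp add: J prod_eq_iff cos_coeff_Suc sin_coeff_Suc algebra_simps del: of_nat_Suc)
    finally show ?case .
  qed
  have "(\<lambda>m. (cos_coeff m * \<theta> ^ m) *\<^sub>R p + (sin_coeff m * \<theta> ^ m) *\<^sub>R J_op p) sums
      (cos \<theta> *\<^sub>R p + sin \<theta> *\<^sub>R J_op p)"
    using cos_converges[of \<theta>] sin_converges[of \<theta>]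
    by (intro sums_add sums_scaleR_left) auto
  then show ?thesis
    unfolding exp_op_def pow
    by (simp add: sums_iff J rotation_def prod_eq_iff)
qed

text \<open>The height \<open>t = a * s\<close> determines \<open>s\<close>, so the rotation angle
  \<open>k * s\<close> is \<open>(k / a) * t\<close>; only the ratio of the parameters matters for
  the set.\<close>

lemma twisted_clifford_eq:
  assumes "a > 0"
  shows "twisted_clifford a k = twisted (k / a)"
proof (intro set_eqI iffI)
  fix x :: "((real^'n) \<times> (real^'n)) \<times> real"
  assume "x \<in> twisted_clifford a k"
  then obtain p s where "x = (rotation (k * s) p, a * s)" "p \<in> clifford_torus"
    by (auto simp: twisted_clifford_def exp_op_J)
  then show "x \<in> twisted (k / a)"
    using assms rotation_rotation[of "- (k * s)" p]
    by (simp add: twisted_eq_vimage untwist_def clifford_torus_def)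
next
  fix x :: "((real^'n) \<times> (real^'n)) \<times> real"
  assume "x \<in> twisted (k / a)"
  then have "rotation (- (k * (snd x / a))) (fst x) \<in> clifford_torus"
    by (simp add: twisted_eq_vimage untwist_def clifford_torus_def)
  moreover have "x = (rotation (k * (snd x / a)) (rotation (- (k * (snd x / a))) (fst x)), a * (snd x / a))"
    using assms by (simp add: rotation_rotation)
  ultimately show "x \<in> twisted_clifford a k"
    unfolding twisted_clifford_def exp_op_J by blast
qed

theorem theorem5:
  fixes n :: nat and a :: real
  assumes "n \<ge> 1" and "CARD('n::finite) = n + 1" and "a > 0"
  defines "M \<equiv> sphere (0 :: (real^'n) \<times> (real^'n)) 1"
  shows "(\<forall>k>0. properly_embedded_hypersurface (M \<times> UNIV) (twisted_clifford a k) \<and>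
            (\<exists>N. vertical_helicoid M (twisted_clifford a k) N)) \<and>
         (\<exists>k>0. \<exists>U N. openin (top_of_set (twisted_clifford a k)) U \<and> U \<noteq> {} \<and>
            zero_mean_isocurved M U N)"
proof (intro conjI allI impI)
  fix k :: real assume "k > 0"
  then show "properly_embedded_hypersurface (M \<times> UNIV) (twisted_clifford a k)"
    "\<exists>N. vertical_helicoid M (twisted_clifford a k) N"
    unfolding M_def twisted_clifford_eq[OF \<open>a > 0\<close>]
    using \<open>a > 0\<close> vertical_helicoid_twisted[of "k / a", where 'b = "real^'n"]
    by (auto intro: properly_embedded_twisted)
next
  \<comment> \<open>The choice \<open>k = 2 * a\<close> gives \<open>c = 2\<close>. At a point with
    \<open>swirl\<close> equal to 1 the squared product is 4, which exceeds 1, so the spacelike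
    region is nonempty.\<close>
  obtain p :: "((real^'n) \<times> (real^'n)) \<times> real" where p: "p \<in> twisted 2" "swirl 2 p = 1"
    using twisted_swirl_ex[of 1] by blast
  have eq: "twisted_clifford a (2 * a) = (twisted 2 :: (((real^'n) \<times> (real^'n)) \<times> real) set)"
    using twisted_clifford_eq[OF \<open>a > 0\<close>, of "2 * a"] \<open>a > 0\<close> by simp
  define U :: "(((real^'n) \<times> (real^'n)) \<times> real) set" where "U = twisted 2 \<inter> {p. 1 < (2 * swirl 2 p)\<^sup>2}"
  show "\<exists>k>0. \<exists>U N. openin (top_of_set (twisted_clifford a k)) U \<and> U \<noteq> {} \<and> zero_mean_isocurved M U N"
  proof (intro exI conjI)
    show "0 < 2 * a" using \<open>a > 0\<close> by simp
    show "openin (top_of_set (twisted_clifford a (2 * a))) U"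
      unfolding eq U_def by (rule openin_twisted_spacelike)
    show "U \<noteq> {}" using p by (auto simp: U_def)
    show "zero_mean_isocurved M U (twist_normal 2)"
      unfolding M_def U_def by (rule zero_mean_isocurved_twisted)
  qed
qed

end
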